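(* There is a function $R:(0,\infty)\to\mathbb{R}$ with $R(p) = O(p^{-1/2})$ as $p\to\infty$ such that the following holds. Let $E$ be a Hermite–Biehler entire function with no real zeros whose phase function satisfies $\varphi' \in L^\infty(\mathbb{R})$. Then for every $0<p<\infty$, $$C(p,E)^p \leq \lVert\varphi'\rVert_\infty \frac{1}{2\sqrt{2\pi}}\left(\sqrt{p} + R(p)\right);$$ in particular the implicit constant in the $O(p^{-1/2})$ term does not depend on $\lVert \varphi'\rVert_\infty$.
   Context: An entire function $E$ is Hermite–Biehler if $\lvert E(\overline{z})\rvert < \lvert E(z)\rvert$ for $z$ in the upper half-plane $\mathbb{C}_+$. Let $E^{\#}(z) = \overline{E(\overline z)}$ and $\Theta_E = E^{\#}/E$, a meromorphic inner function; the phase function $\varphi$ is a smooth real function on $\mathbb{R}$ with $\Theta_E(x) = e^{i\varphi(x)}$ (equivalently $\varphi = -2\arg E$ on $\mathbb{R}$); it is increasing. For $0<p<\infty$, $\mathcal{H}^p(E)$ is the space of entire $f$ such that $f/E$ and $f^{\#}/E$ belong to the Hardy space $H^p(\mathbb{C}_+)$, with $\lVert f/E\rVert_p = (\int_{\mathbb{R}}\lvert f(x)/E(x)\rvert^p dx)^{1/p}$; $\mathcal{H}^\infty(E)$ is defined analogously with bounded analytic functions and $\lVert f/E\rVert_\infty = \sup_{x\in\mathbb{R}}\lvert f(x)/E(x)\rvert$. When $\varphi'\in L^\infty$, $\mathcal{H}^p(E)\subset\mathcal{H}^\infty(E)$, and $C(p,E)$ denotes the norm of the embedding $\mathcal{H}^p(E)\to\mathcal{H}^\infty(E)$,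 i.e. the smallest constant with $\lVert f/E\rVert_\infty\le C(p,E)\lVert f/E\rVert_p$ for all $f\in\mathcal{H}^p(E)$. *)

theory Defs
  imports "HOL-Analysis.Analysis" "HOL-Library.Landau_Symbols"
begin

definition upper_half_plane :: "complex set" where
  "upper_half_plane = {z. Im z > 0}"

definition hermite_biehler :: "(complex \<Rightarrow> complex) \<Rightarrow> bool" where
  "hermite_biehler E \<longleftrightarrow> E holomorphic_on UNIV \<and>
     (\<forall>z. Im z > 0 \<longrightarrow> norm (E (cnj z)) < norm (E z))"

definition sharp :: "(complex \<Rightarrow> complex) \<Rightarrow> complex \<Rightarrow> complex" where
  "sharp f z = cnj (f (cnj z))"

definition Theta :: "(complex \<Rightarrow> complex) \<Rightarrow> complex \<Rightarrow> complex" where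
  "Theta E z = sharp E z / E z"

definition phase_function :: "(complex \<Rightarrow> complex) \<Rightarrow> (real \<Rightarrow> real) \<Rightarrow> bool" where
  "phase_function E phi \<longleftrightarrow> (\<forall>x. phi differentiable (at x)) \<and>
     (\<forall>x::real. Theta E (complex_of_real x) = exp (\<i> * complex_of_real (phi x)))"

definition hardy :: "real \<Rightarrow> (complex \<Rightarrow> complex) set" where
  "hardy p = {F. F holomorphic_on upper_half_plane \<and>
     (\<exists>M::real. \<forall>y>0. (\<integral>\<^sup>+ x. ennreal (norm (F (Complex x y)) powr p) \<partial>lborel) \<le> ennreal M)}"

definition HpE :: "real \<Rightarrow> (complex \<Rightarrow> complex) \<Rightarrow> (complex \<Rightarrow> complex) set" where
  "HpE p E = {f. f holomorphic_on UNIV \<and> (\<lambda>z. f z / E z) \<in> hardy p \<and>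
                 (\<lambda>z. sharp f z / E z) \<in> hardy p}"

definition normp_E :: "real \<Rightarrow> (complex \<Rightarrow> complex) \<Rightarrow> (complex \<Rightarrow> complex) \<Rightarrow> real" where
  "normp_E p E f = (\<integral>x. norm (f (complex_of_real x) / E (complex_of_real x)) powr p \<partial>lborel) powr (1/p)"

definition norminf_E :: "(complex \<Rightarrow> complex) \<Rightarrow> (complex \<Rightarrow> complex) \<Rightarrow> ennreal" where
  "norminf_E E f = (SUP x::real. ennreal (norm (f (complex_of_real x) / E (complex_of_real x))))"

definition C_embed :: "real \<Rightarrow> (complex \<Rightarrow> complex) \<Rightarrow> ennreal" where
  "C_embed p E = Inf {C. \<forall>f\<in>HpE p E. norminf_E E f \<le> C * ennreal (normp_E p E f)}"

text \<open>||phi'||_infinity (phi' is continuous, so sup = ess sup).\<close>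
definition sup_norm :: "(real \<Rightarrow> real) \<Rightarrow> real" where
  "sup_norm g = Sup (range (\<lambda>x. \<bar>g x\<bar>))"

end

theory Submission
  imports Defs "HOL-Complex_Analysis.Complex_Analysis"
begin

text \<open>
  Write $F = f/E$ and $\tau = \sup\varphi'$. On the real line $\Theta_E$ is $\tau$-Lipschitz, and
  by the maximum principle this controls its decay off the line, so that $F$ is holomorphic in a strip below the
  real axis and there obeys the same integral bounds as in the upper half plane; hence $F$ is bounded.
  Normalise $f$ to be real on the real line and $|F| < 1$, so that $F = \gamma e^{i\varphi/2}$ on the
  real line with $\gamma$ real. The inequality $|\Theta_E - \overline\omega F| \le |1 - \omega F|$ (for $|\omega| = 1$)
  holds on the upper half plane with equality on the real line; comparing normal derivatives
  there and choosing $\omega$ well gives $|\gamma'| \le (\varphi'/2)\sqrt{1 - \gamma^2}$. So, near a point where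
  $|F|$ is almost maximal, $|F|$ dominates a cosine of frequency $\tau/2$, whence
  $\|F\|_\infty^p \int_{-\pi/2}^{\pi/2}\cos^p \le (\tau/2) \|F\|_p^p$. The cosine integral is
  $B(1/2, (p+1)/2) \ge \sqrt{2\pi/(p+1)}$, which allows $R(p) = \sqrt{p+1} - \sqrt p$.
\<close>

section \<open>Bounded functions on a half plane\<close>

text \<open>The Hardy condition only controls integrals along horizontal lines above the real axis,
  whereas the maximum principle on a half plane needs an a priori bound up to the axis. Averages
  over squares give one, but squares centred near the axis reach below it. There |f(z)/E(z)| is
  |f#(conj z)/E(conj z)| divided by |\<Theta>(conj z)|, where f# is \<open>sharp f\<close>. So the
  condition on f# takes over as long as \<Theta> stays away from 0, and this is what bounded \<phi>'
  ensures near the axis. The bound |F| < 1 is kept strict and uniform: it holds 1 - \<omega>F away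
  from 0 and makes arccos differentiable along \<gamma>. Hence f/E is divided by some B above its
  supremum, and B tends to the supremum only after the cosine bound is available. In the constant
  1/(2 sqrt(2 pi)), the 2 comes from the frequency \<tau>/2 and sqrt(2 pi) from the bound for the
  cosine integral.\<close>

lemma half_plane_maximum_principle:
  fixes h :: "complex \<Rightarrow> complex"
  assumes hol: "h holomorphic_on {z. Im z > 0}"
    and cont: "continuous_on {z. Im z \<ge> 0} h"
    and bounded: "\<And>z. Im z \<ge> 0 \<Longrightarrow> norm (h z) \<le> C"
    and real: "\<And>x. norm (h (complex_of_real x)) \<le> B"
    and w: "Im w \<ge> 0"
  shows "norm (h w) \<le> B"
proof (cases "Im w = 0")
  case True
  then have "w = complex_of_real (Re w)" by (simp add: complex_eq_iff)
  with real show ?thesis by metis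
next
  case False
  with w have w: "Im w > 0" by simp
  have B: "B \<ge> 0" using real[of 0] norm_ge_zero by (rule order_trans[rotated])
  have C: "C \<ge> 0" using order_trans[OF norm_ge_zero bounded[of 0]] by simp
  \<comment> \<open>The Phragmen-Lindelof device: the divisor has modulus at least 1 on the closed
    half plane and grows linearly, so the crude bound \<open>C\<close> makes the quotient small on
    large arcs. Letting \<open>d\<close> tend to 0 removes the divisor.\<close>
  have le: "norm (h w) \<le> (B + d) * norm (1 - \<i> * d * w)" if d: "d > 0" for d :: real
  proof -
    \<comment> \<open>The second entry gives |1 - \<i> d z| \<ge> C/d + 1 on the arc, hence a
      quotient of at most C/(C/d + 1) \<le> d; the first puts \<open>w\<close> inside the
      ball.\<close>
    define R where "R = max (norm w + 1) ((C / d + 2) / d)"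
    define S where "S = {z. Im z > 0} \<inter> ball (0::complex) R"
    have S: "open S" "bounded S" "w \<in> S"
      using w by (auto simp: S_def R_def open_halfspace_Im_gt)
    have cl: "closure S \<subseteq> {z. Im z \<ge> 0} \<inter> cball 0 R"
      by (rule closure_minimal) (auto simp: S_def closed_halfspace_Im_ge intro!: closed_Int)
    have ge1: "norm (1 - \<i> * d * z) \<ge> 1" if "Im z \<ge> 0" for z
    proof -
      have "1 + d * Im z \<le> norm (1 - \<i> * d * z)"
        using complex_Re_le_cmod[of "1 - \<i> * d * z"] by simp
      moreover have "d * Im z \<ge> 0" using that d by simp
      ultimately show ?thesis by simp
    qed
    have nz: "1 - \<i> * d * z \<noteq> 0" if "Im z \<ge> 0" for z using ge1[OF that] by force
    define g where "g = (\<lambda>z. h z / (1 - \<i> * d * z))"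
    have "norm (g w) \<le> B + d"
    proof (rule maximum_modulus_frontier[of g S])
      show "g holomorphic_on interior S"
        unfolding g_def using nz
        by (intro holomorphic_intros holomorphic_on_subset[OF hol])
           (use S in \<open>auto simp: interior_open, auto simp: S_def\<close>)
      show "continuous_on (closure S) g"
        unfolding g_def using nz cl
        by (intro continuous_intros continuous_on_subset[OF cont]) auto
      show "norm (g z) \<le> B + d" if "z \<in> frontier S" for z
      proof -
        have z: "Im z \<ge> 0" "norm z \<le> R" "z \<notin> S"
          using that cl S by (auto simp: frontier_def interior_open)
        show ?thesis
        proof (cases "Im z = 0")
          case True
          then have "z = complex_of_real (Re z)" by (simp add: complex_eq_iff)
          then have "norm (h z) \<le> B" using real by metis
          moreover have "norm (g z) \<le> norm (h z)"
            unfolding g_def norm_divide using ge1[OF z(1)]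
            by (metis divide_right_mono div_by_1 frac_le norm_ge_zero order_refl zero_less_one)
          ultimately show ?thesis using d by simp
        next
          case False
          with z have "norm z = R" by (auto simp: S_def)
          then have "norm (\<i> * d * z) \<ge> C / d + 2"
            using d by (simp add: norm_mult R_def field_simps max_def)
          then have "norm (1 - \<i> * d * z) \<ge> C / d + 1"
            using norm_triangle_ineq2[of "\<i> * d * z" 1] by (simp add: norm_minus_commute)
          moreover have "C / d + 1 > 0" using C d by (simp add: add_nonneg_pos)
          ultimately have "norm (g z) \<le> C / (C / d + 1)"
            unfolding g_def norm_divide using bounded[OF z(1)] C by (intro frac_le) auto
          also have "\<dots> \<le> d" using C d by (simp add: field_simps)
          finally show ?thesis using B by simp
        qed
      qed
    qed (use S in auto)
    then show ?thesis using nz[of w] w by (simp add: g_def norm_divide field_simps)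
  qed
  have "((\<lambda>d. (B + d) * norm (1 - \<i> * complex_of_real d * w)) \<longlongrightarrow> (B + 0) * norm (1 - \<i> * complex_of_real 0 * w)) (at_right 0)"
    by (intro tendsto_intros)
  then have "norm (h w) \<le> (B + 0) * norm (1 - \<i> * complex_of_real 0 * w)"
    by (rule tendsto_lowerbound) (auto simp: eventually_at_right_less le intro!: eventually_mono[OF eventually_at_right_less])
  then show ?thesis by simp
qed

text \<open>A complex derivative does not depend on the direction: horizontal difference quotients
  bound it by \<open>L\<close>, and this bound then controls vertical increments.\<close>

lemma half_plane_lipschitz_vertical:
  fixes h :: "complex \<Rightarrow> complex"
  assumes hol: "h holomorphic_on {z. Im z > 0}"
    and cont: "continuous_on {z. Im z \<ge> 0} h"
    and bounded: "\<And>z. Im z \<ge> 0 \<Longrightarrow> norm (h z) \<le> C"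
    and real: "\<And>x y. norm (h (complex_of_real x) - h (complex_of_real y)) \<le> L * \<bar>x - y\<bar>"
    and y: "y \<ge> 0"
  shows "norm (h (Complex x y) - h (complex_of_real x)) \<le> L * y"
proof -
  have C: "C \<ge> 0" using order_trans[OF norm_ge_zero bounded[of 0]] by simp
  \<comment> \<open>The difference quotients in real directions are bounded, so the maximum principle applies to them; it need not apply to \<open>h'\<close>.\<close>
  have L: "norm (h (z + complex_of_real d) - h z) \<le> L * \<bar>d\<bar>" if "Im z \<ge> 0" for z d
  proof (rule half_plane_maximum_principle[where h = "\<lambda>z. h (z + complex_of_real d) - h z" and C = "2 * C"])
    show "(\<lambda>z. h (z + complex_of_real d) - h z) holomorphic_on {z. 0 < Im z}"
      by (intro holomorphic_intros hol holomorphic_on_compose_gen[OF _ hol, unfolded o_def]) auto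
    show "continuous_on {z. 0 \<le> Im z} (\<lambda>z. h (z + complex_of_real d) - h z)"
      by (intro continuous_intros cont continuous_on_compose2[OF cont]) auto
    show "norm (h (z + complex_of_real d) - h z) \<le> 2 * C" if "Im z \<ge> 0" for z
      using norm_triangle_ineq4[of "h (z + complex_of_real d)" "h z"] bounded[of z]
        bounded[of "z + complex_of_real d"] that by simp
    show "norm (h (complex_of_real x + complex_of_real d) - h (complex_of_real x)) \<le> L * \<bar>d\<bar>" for x
      using real[of "x + d" x] by simp
  qed (use that in auto)
  have op: "open {z. Im z > 0}" by (rule open_halfspace_Im_gt)
  have D: "norm (deriv h z) \<le> L" if z: "Im z > 0" for z
  proof -
    have "(h has_field_derivative deriv h z) (at z)"
      using hol op z by (intro holomorphic_derivI) auto
    then have *: "((\<lambda>d. (h (z + d) - h z) / d) \<longlongrightarrow> deriv h z) (at 0)" by (simp add: DERIV_def)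
    have "filterlim complex_of_real (at 0) (at_right 0)"
      by (auto intro!: filterlim_atI tendsto_eq_intros simp: eventually_at_filter)
    from filterlim_compose[OF * this] have "((\<lambda>d. norm ((h (z + of_real d) - h z) / of_real d)) \<longlongrightarrow> norm (deriv h z)) (at_right (0::real))"
      by (rule tendsto_norm)
    then show ?thesis
    proof (rule tendsto_upperbound)
      show "\<forall>\<^sub>F d in at_right (0::real). norm ((h (z + of_real d) - h z) / of_real d) \<le> L"
      proof (rule eventually_mono[OF eventually_at_right_less])
        fix d :: real assume "0 < d"
        with L[of z d] z show "norm ((h (z + of_real d) - h z) / of_real d) \<le> L"
          by (simp add: norm_divide divide_le_eq)
      qed
    qed auto
  qed
  \<comment> \<open>The derivative is bounded only in the open half plane, so the segment is lifted
    by \<open>e\<close>; continuity up to the real line allows \<open>e\<close> to tend to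
    0.\<close>
  have "norm (h (Complex x (y + e)) - h (Complex x e)) \<le> L * y" if e: "e > 0" for e
  proof -
    have "norm (h (Complex x (y + e)) - h (Complex x e)) \<le> L * norm (Complex x (y + e) - Complex x e)"
    proof (rule field_differentiable_bound[where S = "{z. Im z > 0}"])
      show "(h has_field_derivative deriv h z) (at z within {z. Im z > 0})" if "z \<in> {z. Im z > 0}" for z
        using hol op that by (intro has_field_derivative_at_within[OF holomorphic_derivI]) auto
    qed (use D e y in \<open>auto simp: convex_halfspace_Im_gt\<close>)
    also have "norm (Complex x (y + e) - Complex x e) = y"
      using y by (simp add: cmod_def)
    finally show ?thesis .
  qed
  note le = this
  have tl: "((\<lambda>e. h (Complex x (c + e))) \<longlongrightarrow> h (Complex x c)) (at_right 0)" if "c \<ge> 0" for c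
  proof -
    have "continuous_on {0..} (\<lambda>e. h (Complex x (c + e)))"
      by (rule continuous_on_compose2[OF cont]) (use that in \<open>auto simp: Complex_eq intro!: continuous_intros\<close>)
    then have "((\<lambda>e. h (Complex x (c + e))) \<longlongrightarrow> h (Complex x (c + 0))) (at 0 within {0..})"
      unfolding continuous_on_def by (rule bspec) simp
    then show ?thesis by (simp add: at_within_Ici_at_right)
  qed
  have "((\<lambda>e. norm (h (Complex x (y + e)) - h (Complex x (0 + e)))) \<longlongrightarrow> norm (h (Complex x y) - h (Complex x 0))) (at_right 0)"
    by (intro tendsto_intros tl y) simp
  then have "norm (h (Complex x y) - h (Complex x 0)) \<le> L * y"
    by (rule tendsto_upperbound) (auto intro!: eventually_mono[OF eventually_at_right_less] le)
  then show ?thesis by (simp add: complex_of_real_def)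
qed

section \<open>Local bounds from integrals over squares\<close>

text \<open>The square has centre \<open>c\<close> and half side \<open>r\<close>. Squares suit the
  Hardy condition better than discs: Fubini turns horizontal line integrals directly into area
  integrals.\<close>

definition square :: "complex \<Rightarrow> real \<Rightarrow> complex set" where
  "square c r = cbox (c - Complex r r) (c + Complex r r)"

lemma Complex_in_square_iff:
  "Complex x y \<in> square c r \<longleftrightarrow> x \<in> {Re c - r..Re c + r} \<and> y \<in> {Im c - r..Im c + r}"
  by (auto simp: square_def in_cbox_complex_iff)

lemma norm_contour_integral_horizontal_le:
  assumes cont: "continuous_on (cbox (Complex a y) (Complex b y)) F" and ab: "a < b" and s: "s > 0"
    and dist: "\<And>x. s \<le> norm (Complex x y - c)"
  shows "norm (contour_integral (linepath (Complex a y) (Complex b y)) (\<lambda>w. F w / (w - c)))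
       \<le> integral {a..b} (\<lambda>x. norm (F (Complex x y))) / s"
proof -
  have ne: "Complex x y \<noteq> c" for x using dist[of x] s by auto
  have C: "continuous_on {a..b} (\<lambda>x. F (Complex x y))"
    by (rule continuous_on_compose2[OF cont]) (auto simp: in_cbox_complex_iff intro!: continuous_intros)
  have "norm (integral {a..b} (\<lambda>x. F (Complex x y) / (Complex x y - c)))
      \<le> integral {a..b} (\<lambda>x. norm (F (Complex x y)) / s)"
  proof (rule integral_norm_bound_integral)
    show "(\<lambda>x. F (Complex x y) / (Complex x y - c)) integrable_on {a..b}"
      by (intro integrable_continuous_interval continuous_intros C) (use ne in auto)
    show "(\<lambda>x. norm (F (Complex x y)) / s) integrable_on {a..b}"
      by (intro integrable_continuous_interval continuous_intros C) (use s in auto)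
    show "norm (F (Complex x y) / (Complex x y - c)) \<le> norm (F (Complex x y)) / s" for x
      unfolding norm_divide using dist[of x] s by (intro divide_left_mono mult_pos_pos) auto
  qed
  moreover have "contour_integral (linepath (Complex a y) (Complex b y)) f = integral {a..b} (\<lambda>x. f (Complex x y))"
    if "continuous_on {a..b} (\<lambda>x. f (Complex x y))" for f
  proof -
    \<comment> \<open>The affine substitution carries the parameter interval of the segment to the
      unit interval used by \<open>linepath\<close>.\<close>
    have "((\<lambda>x. f (Complex x y)) has_integral integral {a..b} (\<lambda>x. f (Complex x y))) (cbox a b)"
      using integrable_integral[OF integrable_continuous_interval[OF that]] by simp
    note * = has_integral_affinity[OF this, of "b - a" a]
    have
      "((\<lambda>x. f (Complex ((b - a) * x + a) y)) has_integral (1 / (b - a)) *\<^sub>R integral {a..b} (\<lambda>x. f (Complex x y))) {0..1}"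
    proof -
      have "(\<lambda>x. (1 / (b - a)) * x + - ((1 / (b - a)) * a)) ` {a..b} = {0..1}"
        using ab by (subst image_affinity_atLeastAtMost) (auto simp: diff_divide_distrib[symmetric])
      with * show ?thesis using ab by simp
    qed
    from has_integral_mult_left[OF this, of "complex_of_real (b - a)"] have
      "((\<lambda>x. f (Complex ((b - a) * x + a) y) * complex_of_real (b - a)) has_integral integral {a..b} (\<lambda>x. f (Complex x y))) {0..1}"
      using ab by (simp add: scaleR_conv_of_real del: of_real_diff)
    moreover have "linepath (Complex a y) (Complex b y) x = Complex ((b - a) * x + a) y" for x
      by (simp add: linepath_def complex_eq_iff algebra_simps)
    moreover have "Complex b y - Complex a y = complex_of_real (b - a)"
      by (simp add: complex_eq_iff)
    ultimately have "(f has_contour_integral integral {a..b} (\<lambda>x. f (Complex x y))) (linepath (Complex a y) (Complex b y))"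
      by (simp only: has_contour_integral_linepath)
    then show ?thesis by (rule contour_integral_unique)
  qed
  moreover have "continuous_on {a..b} (\<lambda>x. F (Complex x y) / (Complex x y - c))"
    by (intro continuous_intros C) (use ne in auto)
  ultimately show ?thesis by simp
qed

lemma norm_contour_integral_vertical_le:
  assumes cont: "continuous_on (cbox (Complex x a) (Complex x b)) F" and ab: "a < b" and s: "s > 0"
    and dist: "\<And>y. s \<le> norm (Complex x y - c)"
  shows "norm (contour_integral (linepath (Complex x a) (Complex x b)) (\<lambda>w. F w / (w - c)))
       \<le> integral {a..b} (\<lambda>y. norm (F (Complex x y))) / s"
proof -
  have ne: "Complex x y \<noteq> c" for y using dist[of y] s by auto
  have C: "continuous_on {a..b} (\<lambda>y. F (Complex x y))"
    by (rule continuous_on_compose2[OF cont]) (auto simp: in_cbox_complex_iff intro!: continuous_intros)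
  have "norm (integral {a..b} (\<lambda>y. F (Complex x y) / (Complex x y - c)))
      \<le> integral {a..b} (\<lambda>y. norm (F (Complex x y)) / s)"
  proof (rule integral_norm_bound_integral)
    show "(\<lambda>y. F (Complex x y) / (Complex x y - c)) integrable_on {a..b}"
      by (intro integrable_continuous_interval continuous_intros C) (use ne in auto)
    show "(\<lambda>y. norm (F (Complex x y)) / s) integrable_on {a..b}"
      by (intro integrable_continuous_interval continuous_intros C) (use s in auto)
    show "norm (F (Complex x y) / (Complex x y - c)) \<le> norm (F (Complex x y)) / s" for y
      unfolding norm_divide using dist[of y] s by (intro divide_left_mono mult_pos_pos) auto
  qed
  then show ?thesis
    by (subst contour_integral_linepath_same_Re[of _ x _ a b]) (use ab in \<open>auto simp: norm_mult\<close>)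
qed

text \<open>Cauchy's integral formula on the boundary of the square, where the kernel 1/(w - c) has
  modulus at most 1/s.\<close>

lemma square_boundary_integral_ge:
  fixes F :: "complex \<Rightarrow> complex"
  assumes hol: "F holomorphic_on square c s" and s: "s > 0"
  shows "2 * pi * s * norm (F c) \<le>
      integral {Re c - s..Re c + s} (\<lambda>x. norm (F (Complex x (Im c - s))))
    + integral {Re c - s..Re c + s} (\<lambda>x. norm (F (Complex x (Im c + s))))
    + integral {Im c - s..Im c + s} (\<lambda>y. norm (F (Complex (Re c - s) y)))
    + integral {Im c - s..Im c + s} (\<lambda>y. norm (F (Complex (Re c + s) y)))"
    (is "_ \<le> ?I1 + ?I2 + ?I3 + ?I4")
proof -
  define h where "h = (\<lambda>w. F w / (w - c))"
  define a1 a2 a3 a4 where "a1 = Complex (Re c - s) (Im c - s)" and "a2 = Complex (Re c + s) (Im c - s)"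
    and "a3 = Complex (Re c + s) (Im c + s)" and "a4 = Complex (Re c - s) (Im c + s)"
  note a = a1_def a2_def a3_def a4_def
  have sq: "square c s = cbox a1 a3"
    by (auto simp: square_def a in_cbox_complex_iff)
  have contF: "continuous_on (square c s) F"
    using hol by (rule holomorphic_on_imp_continuous_on)
  have re: "s \<le> norm (w - c)" if "\<bar>Re w - Re c\<bar> = s \<or> \<bar>Im w - Im c\<bar> = s" for w
    using that abs_Re_le_cmod[of "w - c"] abs_Im_le_cmod[of "w - c"] by auto
  have rp: "rectpath a1 a3 = linepath a1 a2 +++ linepath a2 a3 +++ linepath a3 a4 +++ linepath a4 a1"
    by (simp add: rectpath_def Let_def a)
  have pi: "path_image (rectpath a1 a3) = cbox a1 a3 - box a1 a3"
    by (rule path_image_rectpath_cbox_minus_box) (use s in \<open>auto simp: a\<close>)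
  have cin: "c \<in> box a1 a3" using s by (auto simp: a in_box_complex_iff)
  have "(h has_contour_integral (2 * pi * \<i> * winding_number (rectpath a1 a3) c * F c)) (rectpath a1 a3)"
    unfolding h_def
    by (rule Cauchy_integral_formula_convex_simple[where S = "cbox a1 a3"])
       (use hol sq pi cin in \<open>auto simp: interior_cbox\<close>)
  then have total: "contour_integral (rectpath a1 a3) h = 2 * pi * \<i> * F c"
    using winding_number_rectpath[OF cin] by (simp add: contour_integral_unique)
  have conth: "continuous_on (path_image (rectpath a1 a3)) h"
    unfolding h_def using pi cin
    by (intro continuous_intros continuous_on_subset[OF contF]) (auto simp: sq)
  have seg: "path_image (rectpath a1 a3) = closed_segment a1 a2 \<union> closed_segment a2 a3 \<union> closed_segment a3 a4 \<union> closed_segment a4 a1"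
    by (simp add: rp path_image_join Un_assoc)
  have int: "h contour_integrable_on linepath a1 a2" "h contour_integrable_on linepath a2 a3"
     "h contour_integrable_on linepath a3 a4" "h contour_integrable_on linepath a4 a1"
    by (intro contour_integrable_continuous_linepath continuous_on_subset[OF conth]; use seg in blast)+
  have split: "contour_integral (rectpath a1 a3) h =
      contour_integral (linepath a1 a2) h + (contour_integral (linepath a2 a3) h
      + (contour_integral (linepath a3 a4) h + contour_integral (linepath a4 a1) h))"
    unfolding rp using int
    by (simp add: contour_integral_join valid_path_join contour_integrable_joinI)
  have rev: "contour_integral (linepath a3 a4) h = - contour_integral (linepath a4 a3) h"
    "contour_integral (linepath a4 a1) h = - contour_integral (linepath a1 a4) h"
    by (intro contour_integral_reverse_linepath continuous_on_subset[OF conth]; use seg in blast)+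
  have I1: "norm (contour_integral (linepath a1 a2) h) \<le> ?I1 / s"
    unfolding h_def a using s
    by (intro norm_contour_integral_horizontal_le continuous_on_subset[OF contF] re)
       (auto simp: sq a in_cbox_complex_iff)
  have I2: "norm (contour_integral (linepath a4 a3) h) \<le> ?I2 / s"
    unfolding h_def a using s
    by (intro norm_contour_integral_horizontal_le continuous_on_subset[OF contF] re)
       (auto simp: sq a in_cbox_complex_iff)
  have I3: "norm (contour_integral (linepath a1 a4) h) \<le> ?I3 / s"
    unfolding h_def a using s
    by (intro norm_contour_integral_vertical_le continuous_on_subset[OF contF] re)
       (auto simp: sq a in_cbox_complex_iff)
  have I4: "norm (contour_integral (linepath a2 a3) h) \<le> ?I4 / s"
    unfolding h_def a using s
    by (intro norm_contour_integral_vertical_le continuous_on_subset[OF contF] re)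
       (auto simp: sq a in_cbox_complex_iff)
  have "2 * pi * norm (F c) = norm (contour_integral (rectpath a1 a3) h)"
    by (simp add: total norm_mult)
  also have "\<dots> \<le> norm (contour_integral (linepath a1 a2) h) + (norm (contour_integral (linepath a2 a3) h)
      + (norm (contour_integral (linepath a4 a3) h) + norm (contour_integral (linepath a1 a4) h)))"
    unfolding split rev by (intro order_trans[OF norm_triangle_ineq] add_mono) (auto simp: norm_minus_cancel)
  also have "\<dots> \<le> ?I1 / s + (?I4 / s + (?I2 / s + ?I3 / s))"
    by (intro add_mono I1 I2 I3 I4)
  finally show ?thesis using s by (simp add: field_simps)
qed

text \<open>Joint measurability for Fubini; \<open>F\<close> is continuous only on the square, hence
  the indicator.\<close>

lemma borel_measurable_square:
  fixes F :: "complex \<Rightarrow> real"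
  assumes "continuous_on (square c r) F"
  shows "(\<lambda>(x, y). ennreal (F (Complex x y)) * indicator (square c r) (Complex x y)) \<in> borel_measurable (lborel \<Otimes>\<^sub>M lborel)"
proof -
  have 1: "(\<lambda>z. indicator (square c r) z *\<^sub>R F z) \<in> borel_measurable borel"
    using assms by (intro borel_measurable_continuous_on_indicator) (auto simp: square_def)
  have 2: "(\<lambda>(x, y). Complex x y) \<in> borel_measurable (borel :: (real \<times> real) measure)"
    by (intro borel_measurable_continuous_onI) (auto simp: case_prod_beta' intro!: continuous_intros)
  have "(\<lambda>(x, y). ennreal (indicator (square c r) (Complex x y) *\<^sub>R F (Complex x y))) \<in> borel_measurable (borel :: (real \<times> real) measure)"
    using measurable_compose[OF measurable_compose[OF 2 1] measurable_ennreal]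
    by (simp add: case_prod_beta')
  also have "(\<lambda>(x, y). ennreal (indicator (square c r) (Complex x y) *\<^sub>R F (Complex x y))) = (\<lambda>(x, y). ennreal (F (Complex x y)) * indicator (square c r) (Complex x y))"
    by (auto simp: indicator_def)
  finally have "(\<lambda>(x, y). ennreal (F (Complex x y)) * indicator (square c r) (Complex x y)) \<in> borel_measurable (borel :: (real \<times> real) measure)" .
  moreover have "sets (lborel \<Otimes>\<^sub>M lborel) = sets (borel :: (real \<times> real) measure)"
    by (metis lborel_prod sets_lborel)
  ultimately show ?thesis using measurable_cong_sets[OF _ refl] by blast
qed

text \<open>The boundary inequality is integrated over the half sides s from r/2 to r. Each of the
  four families of sides sweeps out part of the square, so each contributes at most the area
  integral, whence the factor 4. On the left, 2 pi s \<ge> pi r and the length r/2 give (pi/2) r^2,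
  at least r^2.\<close>

lemma square_mean_value_ineq:
  fixes F :: "complex \<Rightarrow> complex"
  assumes hol: "F holomorphic_on square c r" and r: "r > 0"
  shows "ennreal (r\<^sup>2 * norm (F c)) \<le>
    4 * (\<integral>\<^sup>+y. \<integral>\<^sup>+x. ennreal (norm (F (Complex x y))) * indicator (square c r) (Complex x y) \<partial>lborel \<partial>lborel)"
proof -
  define u where "u = (\<lambda>x y. ennreal (norm (F (Complex x y))) * indicator (square c r) (Complex x y))"
  define A where "A = (\<integral>\<^sup>+y. \<integral>\<^sup>+x. u x y \<partial>lborel \<partial>lborel)"
  have contF: "continuous_on (square c r) F"
    using hol by (rule holomorphic_on_imp_continuous_on)
  have [measurable]: "(\<lambda>(x, y). u x y) \<in> borel_measurable (lborel \<Otimes>\<^sub>M lborel)"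
    unfolding u_def by (intro borel_measurable_square continuous_intros contF)
  have A2: "(\<integral>\<^sup>+x. \<integral>\<^sup>+y. u x y \<partial>lborel \<partial>lborel) = A"
    unfolding A_def by (rule lborel_pair.Fubini') measurable
  have nn: "ennreal (integral {a..b} (\<lambda>x. norm (F (g x)))) \<le> (\<integral>\<^sup>+x. ennreal (norm (F (g x))) * indicator (square c r) (g x) \<partial>lborel)"
    if "continuous_on {a..b} g" "g ` {a..b} \<subseteq> square c r" for a b and g :: "real \<Rightarrow> complex"
  proof -
    have C: "continuous_on {a..b} (\<lambda>x. norm (F (g x)))"
      using that by (intro continuous_intros continuous_on_compose2[OF contF]) auto
    have "ennreal (integral {a..b} (\<lambda>x. norm (F (g x)))) = (\<integral>\<^sup>+x. ennreal (norm (F (g x))) * indicator {a..b} x \<partial>lborel)"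
      using nn_integral_has_integral_lebesgue[OF _ integrable_integral[OF integrable_continuous_interval[OF C]]]
      by (simp add: ennreal_mult' ennreal_indicator mult.commute)
    also have "\<dots> \<le> (\<integral>\<^sup>+x. ennreal (norm (F (g x))) * indicator (square c r) (g x) \<partial>lborel)"
      using that by (intro nn_integral_mono) (force simp: indicator_def)
    finally show ?thesis .
  qed
  have ep: "ennreal (a + b) \<le> ennreal a + ennreal b" for a b :: real
    by (cases "a \<ge> 0"; cases "b \<ge> 0") (auto simp: ennreal_neg intro: ennreal_leI)
  \<comment> \<open>The coefficients -1 and 1 are written out so that both signs are instances of
    one affine substitution with factor of modulus 1.\<close>
  have ptw: "ennreal (pi * r * norm (F c)) \<le> (\<integral>\<^sup>+x. u x (Im c + (-1) * s) \<partial>lborel) + (\<integral>\<^sup>+x. u x (Im c + 1 * s) \<partial>lborel)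
      + (\<integral>\<^sup>+y. u (Re c + (-1) * s) y \<partial>lborel) + (\<integral>\<^sup>+y. u (Re c + 1 * s) y \<partial>lborel)"
    if s: "s \<in> {r/2..r}" for s
  proof -
    have s0: "s > 0" using s r by auto
    have "square c s \<subseteq> square c r" using s by (auto simp: square_def in_cbox_complex_iff)
    then have hol': "F holomorphic_on square c s" using hol by (rule holomorphic_on_subset[rotated])
    have "pi * r * norm (F c) \<le> 2 * pi * s * norm (F c)"
      using s by (intro mult_right_mono) auto
    also note square_boundary_integral_ge[OF hol' s0]
    finally have "ennreal (pi * r * norm (F c)) \<le> ennreal (
      integral {Re c - s..Re c + s} (\<lambda>x. norm (F (Complex x (Im c - s))))
    + integral {Re c - s..Re c + s} (\<lambda>x. norm (F (Complex x (Im c + s))))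
    + integral {Im c - s..Im c + s} (\<lambda>y. norm (F (Complex (Re c - s) y)))
    + integral {Im c - s..Im c + s} (\<lambda>y. norm (F (Complex (Re c + s) y))))"
      by (rule ennreal_leI)
    also have "\<dots> \<le> ennreal (integral {Re c - s..Re c + s} (\<lambda>x. norm (F (Complex x (Im c - s)))))
    + ennreal (integral {Re c - s..Re c + s} (\<lambda>x. norm (F (Complex x (Im c + s)))))
    + ennreal (integral {Im c - s..Im c + s} (\<lambda>y. norm (F (Complex (Re c - s) y))))
    + ennreal (integral {Im c - s..Im c + s} (\<lambda>y. norm (F (Complex (Re c + s) y))))"
      by (intro order_trans[OF ep] add_mono order_refl)
    also have "\<dots> \<le> (\<integral>\<^sup>+x. u x (Im c - s) \<partial>lborel) + (\<integral>\<^sup>+x. u x (Im c + s) \<partial>lborel)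
      + (\<integral>\<^sup>+y. u (Re c - s) y \<partial>lborel) + (\<integral>\<^sup>+y. u (Re c + s) y \<partial>lborel)"
      unfolding u_def using s s0
      by (intro add_mono nn continuous_intros) (auto simp: Complex_in_square_iff)
    finally show ?thesis by simp
  qed
  have "ennreal (r\<^sup>2 * norm (F c)) \<le> ennreal (pi * r * norm (F c)) * ennreal (r/2)"
  proof -
    have "r\<^sup>2 * norm (F c) \<le> (r\<^sup>2 * norm (F c)) * (pi / 2)"
      using mult_left_mono[of 1 "pi / 2" "r\<^sup>2 * norm (F c)"] pi_ge_two by simp
    then show ?thesis using r
      by (subst ennreal_mult[symmetric]) (auto intro!: ennreal_leI simp: power2_eq_square mult_ac)
  qed
  also have "\<dots> = (\<integral>\<^sup>+s. ennreal (pi * r * norm (F c)) * indicator {r/2..r} s \<partial>lborel)"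
    using r by (subst nn_integral_cmult_indicator) auto
  also have "\<dots> \<le> (\<integral>\<^sup>+s. (\<integral>\<^sup>+x. u x (Im c + (-1) * s) \<partial>lborel) + (\<integral>\<^sup>+x. u x (Im c + 1 * s) \<partial>lborel)
      + (\<integral>\<^sup>+y. u (Re c + (-1) * s) y \<partial>lborel) + (\<integral>\<^sup>+y. u (Re c + 1 * s) y \<partial>lborel) \<partial>lborel)"
    using ptw by (intro nn_integral_mono) (auto simp: indicator_def)
  also have "\<dots> = (\<integral>\<^sup>+s. \<integral>\<^sup>+x. u x (Im c + (-1) * s) \<partial>lborel \<partial>lborel) + (\<integral>\<^sup>+s. \<integral>\<^sup>+x. u x (Im c + 1 * s) \<partial>lborel \<partial>lborel)
      + (\<integral>\<^sup>+s. \<integral>\<^sup>+y. u (Re c + (-1) * s) y \<partial>lborel \<partial>lborel) + (\<integral>\<^sup>+s. \<integral>\<^sup>+y. u (Re c + 1 * s) y \<partial>lborel \<partial>lborel)"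
    by (simp add: nn_integral_add)
  also have "\<dots> = A + A + A + A"
  proof -
    have 1: "(\<integral>\<^sup>+s. \<integral>\<^sup>+x. u x (Im c + k * s) \<partial>lborel \<partial>lborel) = A" if "\<bar>k\<bar> = 1" for k
      unfolding A_def using that
      by (subst nn_integral_real_affine[of "\<lambda>y. \<integral>\<^sup>+x. u x y \<partial>lborel" k "Im c"]) auto
    have 2: "(\<integral>\<^sup>+s. \<integral>\<^sup>+y. u (Re c + k * s) y \<partial>lborel \<partial>lborel) = A" if "\<bar>k\<bar> = 1" for k
      unfolding A2[symmetric] using that
      by (subst nn_integral_real_affine[of "\<lambda>x. \<integral>\<^sup>+y. u x y \<partial>lborel" k "Re c"]) auto
    show ?thesis using 1[of "-1"] 1[of 1] 2[of "-1"] 2[of 1] by simp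
  qed
  also have "\<dots> = 4 * A"
  proof -
    have "(4::ennreal) = 1 + 1 + 1 + 1" by simp
    then show ?thesis by (simp only: distrib_right mult_1_left)
  qed
  finally show ?thesis unfolding A_def u_def .
qed

text \<open>Needed for exponents below 1, where integrability of a power of |F| gives no direct
  bound on the integral of |F| itself.\<close>

lemma square_mean_value_ineq_powr:
  fixes F :: "complex \<Rightarrow> complex" and q :: real
  assumes hol: "F holomorphic_on square c r" and r: "r > 0" and q: "0 < q" "q \<le> 1"
    and A: "(\<integral>\<^sup>+y. \<integral>\<^sup>+x. ennreal (norm (F (Complex x y)) powr q) * indicator (square c r) (Complex x y) \<partial>lborel \<partial>lborel) \<le> ennreal A"
    and "A \<ge> 0"
  shows "r\<^sup>2 * norm (F c) powr q \<le> 16 * 4 powr ((1 - q) / q) * A"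
proof -
  \<comment> \<open>At a maximum point \<open>w\<close> of \<open>d\<^sup>2 |F|\<^sup>q\<close> the factor \<open>|F|\<close> to the power \<open>1 - q\<close> is, up to a constant, largest at \<open>w\<close> on the square of
    half the size, which reduces the claim to the case \<open>q = 1\<close> without subharmonicity.\<close>
  define d where "d w = r - max \<bar>Re w - Re c\<bar> \<bar>Im w - Im c\<bar>" for w
  define m where "m = (\<lambda>w. (d w)\<^sup>2 * norm (F w) powr q)"
  have contF: "continuous_on (square c r) F"
    using hol by (rule holomorphic_on_imp_continuous_on)
  have "continuous_on (square c r) m"
    unfolding m_def d_def using q by (intro continuous_intros contF continuous_on_powr') auto
  moreover have "compact (square c r)" by (simp add: square_def)
  moreover have cin: "c \<in> square c r" using r by (auto simp: square_def in_cbox_complex_iff)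
  ultimately obtain w where w: "w \<in> square c r" and wmax: "\<And>v. v \<in> square c r \<Longrightarrow> m v \<le> m w"
    using continuous_attains_sup[of "square c r" m] by auto
  have dw: "0 \<le> d w" using w by (auto simp: d_def square_def in_cbox_complex_iff)
  have "r\<^sup>2 * norm (F c) powr q = m c" by (simp add: m_def d_def)
  also have "m c \<le> m w" by (rule wmax[OF cin])
  also have "m w \<le> 16 * 4 powr ((1 - q) / q) * A"
  proof (cases "d w = 0 \<or> F w = 0")
    case True
    then show ?thesis using \<open>A \<ge> 0\<close> by (auto simp: m_def)
  next
    case False
    then have d: "d w > 0" and Fw: "norm (F w) > 0" using dw by auto
    define K where "K = 4 powr ((1 - q) / q) * norm (F w) powr (1 - q)"
    have dle: "d w \<le> r - \<bar>Re w - Re c\<bar>" "d w \<le> r - \<bar>Im w - Im c\<bar>" by (auto simp: d_def)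
    have near: "\<bar>Re v - Re w\<bar> \<le> d w / 2" "\<bar>Im v - Im w\<bar> \<le> d w / 2" if "v \<in> square w (d w / 2)" for v
    proof -
      have "Re w - d w / 2 \<le> Re v \<and> Re v \<le> Re w + d w / 2 \<and> Im w - d w / 2 \<le> Im v \<and> Im v \<le> Im w + d w / 2"
        using that by (simp add: square_def in_cbox_complex_iff)
      then show "\<bar>Re v - Re w\<bar> \<le> d w / 2" "\<bar>Im v - Im w\<bar> \<le> d w / 2" by linarith+
    qed
    have sub: "square w (d w / 2) \<subseteq> square c r"
    proof
      fix v assume "v \<in> square w (d w / 2)"
      with near[of v] dle d show "v \<in> square c r"
        unfolding square_def in_cbox_complex_iff by simp linarith
    qed
    have pt: "norm (F v) \<le> K * norm (F v) powr q" if v: "v \<in> square w (d w / 2)" for v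
    proof (cases "F v = 0")
      case False
      have "d v \<ge> d w / 2" 
      proof -
        have "max \<bar>Re v - Re c\<bar> \<bar>Im v - Im c\<bar> \<le> r - d w / 2"
          using near[OF v] dle by (intro max.boundedI) linarith+
        then show ?thesis unfolding d_def[of v] by linarith
      qed
      then have "(d w / 2)\<^sup>2 * norm (F v) powr q \<le> m v"
        using d unfolding m_def by (intro mult_right_mono power_mono) auto
      also have "m v \<le> m w" using v sub by (intro wmax) auto
      finally have "norm (F v) powr q \<le> 4 * norm (F w) powr q"
        using d by (simp add: m_def power2_eq_square field_simps)
      \<comment> \<open>The exponent turns a bound for |F|^q into one for |F|^(1 - q); this produces
        the constant \<open>4 powr ((1 - q) / q)\<close>.\<close>
      then have "(norm (F v) powr q) powr ((1 - q) / q) \<le> (4 * norm (F w) powr q) powr ((1 - q) / q)"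
        using q by (intro powr_mono2) auto
      then have "norm (F v) powr (1 - q) \<le> K"
        using q by (simp add: K_def powr_mult powr_powr)
      then have "norm (F v) powr (1 - q) * norm (F v) powr q \<le> K * norm (F v) powr q"
        by (intro mult_right_mono) auto
      then show ?thesis using False by (simp flip: powr_add)
    qed auto
    have K: "K \<ge> 0" by (simp add: K_def)
    \<comment> \<open>The 16 is the 4 of the mean value inequality times the 4 from halving the
      side. The factor |F w|^(1 - q) hidden in \<open>K\<close> is cancelled at the end, leaving |F
      w|^q on the left.\<close>
    have "ennreal ((d w / 2)\<^sup>2 * norm (F w)) \<le>
      4 * (\<integral>\<^sup>+y. \<integral>\<^sup>+x. ennreal (norm (F (Complex x y))) * indicator (square w (d w / 2)) (Complex x y) \<partial>lborel \<partial>lborel)"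
      using d by (intro square_mean_value_ineq holomorphic_on_subset[OF hol sub]) auto
    also have "\<dots> \<le> 4 * (\<integral>\<^sup>+y. \<integral>\<^sup>+x. ennreal K * (ennreal (norm (F (Complex x y)) powr q) * indicator (square c r) (Complex x y)) \<partial>lborel \<partial>lborel)"
      using pt sub K
      by (intro mult_left_mono nn_integral_mono)
         (auto simp: indicator_def ennreal_mult[symmetric] intro!: ennreal_leI)
    also have "\<dots> = 4 * (ennreal K * (\<integral>\<^sup>+y. \<integral>\<^sup>+x. ennreal (norm (F (Complex x y)) powr q) * indicator (square c r) (Complex x y) \<partial>lborel \<partial>lborel))"
    proof -
      have [measurable]: "(\<lambda>(x, y). ennreal (norm (F (Complex x y)) powr q) * indicator (square c r) (Complex x y)) \<in> borel_measurable (lborel \<Otimes>\<^sub>M lborel)"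
        using q by (intro borel_measurable_square continuous_intros contF continuous_on_powr') auto
      show ?thesis by (simp add: nn_integral_cmult)
    qed
    also have "\<dots> \<le> 4 * (ennreal K * ennreal A)" by (intro mult_left_mono A) auto
    also have "\<dots> = ennreal (4 * (K * A))" using K \<open>A \<ge> 0\<close> by (simp add: ennreal_mult)
    finally have "(d w / 2)\<^sup>2 * norm (F w) \<le> 4 * (K * A)" using K \<open>A \<ge> 0\<close> by (simp add: ennreal_le_iff)
    moreover have "norm (F w) = norm (F w) powr q * norm (F w) powr (1 - q)"
      using Fw by (simp flip: powr_add)
    ultimately have "norm (F w) powr (1 - q) * m w \<le> norm (F w) powr (1 - q) * (16 * 4 powr ((1 - q) / q) * A)"
      by (simp add: m_def K_def power2_eq_square field_simps)
    then show ?thesis using Fw by (simp add: mult_le_cancel_left_pos)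
  qed
  finally show ?thesis .
qed

text \<open>Squares of the fixed half side \<rho>/2 around points of the closed half plane stay in
  the domain, and their area integrals are bounded independently of the centre. The real line may be
  left out of the hypothesis because it is a null set of heights.\<close>

lemma bounded_if_horizontal_integrals_bounded:
  fixes F :: "complex \<Rightarrow> complex" and p :: real
  assumes hol: "F holomorphic_on {z. Im z > -\<rho>}" and \<rho>: "\<rho> > 0" and p: "p > 0"
    and M: "\<And>y. y > -\<rho> \<Longrightarrow> y \<noteq> 0 \<Longrightarrow> (\<integral>\<^sup>+x. ennreal (norm (F (Complex x y)) powr p) \<partial>lborel) \<le> ennreal M"
  shows "\<exists>C. \<forall>z. Im z \<ge> 0 \<longrightarrow> norm (F z) \<le> C"
proof -
  define q where "q = min p 1"
  have q: "0 < q" "q \<le> 1" "q \<le> p" using p by (auto simp: q_def)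
  define r where "r = \<rho> / 2"
  have r: "r > 0" "r < \<rho>" using \<rho> by (auto simp: r_def)
  \<comment> \<open>A row contributes at most the \<open>p\<close>-integral plus the width 2r,
    because t^q \<le> t^p + 1; the last factor is the height.\<close>
  define A where "A = (max M 0 + 2 * r) * (2 * r)"
  define K where "K = 16 * 4 powr ((1 - q) / q) * A"
  have A: "A \<ge> 0" using r by (auto simp: A_def)
  have "norm (F c) \<le> (K / r\<^sup>2) powr (1 / q)" if c: "Im c \<ge> 0" for c
  proof -
    have sub: "square c r \<subseteq> {z. Im z > -\<rho>}"
      using c r by (auto simp: square_def in_cbox_complex_iff)
    have row: "(\<integral>\<^sup>+x. ennreal (norm (F (Complex x y)) powr q) * indicator (square c r) (Complex x y) \<partial>lborel)
        \<le> ennreal (max M 0 + 2 * r) * indicator {Im c - r..Im c + r} y" if "y \<noteq> 0" for y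
    proof (cases "y \<in> {Im c - r..Im c + r}")
      case True
      then have y: "y > -\<rho>" using c r by auto
      have F: "continuous_on UNIV (\<lambda>x. F (Complex x y))"
        by (rule continuous_on_compose2[OF holomorphic_on_imp_continuous_on[OF hol]])
           (use y in \<open>auto intro!: continuous_intros\<close>)
      have [measurable]: "(\<lambda>x. norm (F (Complex x y)) powr p) \<in> borel_measurable borel"
        using p by (intro borel_measurable_continuous_onI continuous_on_powr' continuous_intros F) auto
      have le: "t powr q \<le> t powr p + 1" if "t \<ge> 0" for t :: real
      proof (cases "t \<le> 1")
        case True
        then have "t powr q \<le> 1" using q that by (intro powr_le1) auto
        then show ?thesis by (simp add: add_increasing)
      next
        case False
        then have "t powr q \<le> t powr p" using q by (intro powr_mono) auto
        then show ?thesis by simp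
      qed
      have "(\<integral>\<^sup>+x. ennreal (norm (F (Complex x y)) powr q) * indicator (square c r) (Complex x y) \<partial>lborel)
          \<le> (\<integral>\<^sup>+x. ennreal (norm (F (Complex x y)) powr p) + indicator {Re c - r..Re c + r} x \<partial>lborel)"
      proof (intro nn_integral_mono)
        fix x
        have "ennreal (norm (F (Complex x y)) powr q) \<le> ennreal (norm (F (Complex x y)) powr p) + 1"
          using le[of "norm (F (Complex x y))"] by (simp flip: ennreal_1 ennreal_plus add: ennreal_leI)
        then show "ennreal (norm (F (Complex x y)) powr q) * indicator (square c r) (Complex x y)
            \<le> ennreal (norm (F (Complex x y)) powr p) + indicator {Re c - r..Re c + r} x"
          by (cases "Complex x y \<in> square c r") (simp_all add: Complex_in_square_iff)
      qed
      also have "\<dots> = (\<integral>\<^sup>+x. ennreal (norm (F (Complex x y)) powr p) \<partial>lborel) + ennreal (2 * r)"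
        using r by (subst nn_integral_add) auto
      also have "\<dots> \<le> ennreal (max M 0) + ennreal (2 * r)"
        by (intro add_right_mono order_trans[OF M[OF y that]] ennreal_leI) auto
      also have "\<dots> = ennreal (max M 0 + 2 * r)" using r by (subst ennreal_plus) auto
      finally show ?thesis using True by simp
    next
      case False
      then have "Complex x y \<notin> square c r" for x by (simp add: Complex_in_square_iff)
      then show ?thesis by simp
    qed
    have "(\<integral>\<^sup>+y. \<integral>\<^sup>+x. ennreal (norm (F (Complex x y)) powr q) * indicator (square c r) (Complex x y) \<partial>lborel \<partial>lborel)
        \<le> (\<integral>\<^sup>+y. ennreal (max M 0 + 2 * r) * indicator {Im c - r..Im c + r} y \<partial>lborel)"
      by (intro nn_integral_mono_AE eventually_mono[OF AE_lborel_singleton[of "0::real"]] row)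
    also have "\<dots> = ennreal (max M 0 + 2 * r) * ennreal (2 * r)"
      using r by (subst nn_integral_cmult_indicator) auto
    also have "\<dots> = ennreal A" using r unfolding A_def by (subst ennreal_mult) auto
    finally have "r\<^sup>2 * norm (F c) powr q \<le> K"
      unfolding K_def by (intro square_mean_value_ineq_powr holomorphic_on_subset[OF hol sub] r q A)
    then have "norm (F c) powr q \<le> K / r\<^sup>2" using r by (simp add: field_simps)
    then have "(norm (F c) powr q) powr (1 / q) \<le> (K / r\<^sup>2) powr (1 / q)"
      using q by (intro powr_mono2) auto
    then show ?thesis using q by (simp add: powr_powr)
  qed
  then show ?thesis by blast
qed

section \<open>A Bernstein-type inequality\<close>

text \<open>Moving upwards multiplies the complex derivative by \<i>; squaring makes the norm
  polynomial in the real and imaginary parts.\<close>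

lemma has_real_derivative_norm_square_vertical:
  assumes "(h has_field_derivative h') (at (complex_of_real x))"
  shows "((\<lambda>y. (norm (h (Complex x y)))\<^sup>2) has_real_derivative 2 * Re (cnj (h (complex_of_real x)) * (\<i> * h'))) (at 0)"
proof -
  have C0: "Complex x 0 = complex_of_real x" by (simp add: complex_of_real_def)
  have "((\<lambda>y. complex_of_real x + y *\<^sub>R \<i>) has_vector_derivative (0 + 1 *\<^sub>R \<i>)) (at (0::real))"
    by (intro derivative_intros has_vector_derivative_scaleR[THEN has_vector_derivative_eq_rhs]) (auto intro!: derivative_eq_intros)
  moreover have "(\<lambda>y. complex_of_real x + y *\<^sub>R \<i>) = Complex x"
    by (auto simp: complex_eq_iff)
  ultimately have "(Complex x has_vector_derivative \<i>) (at 0)" by simp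
  then have "((h \<circ> Complex x) has_vector_derivative (\<i> * h')) (at 0)"
    using assms C0 by (intro field_vector_diff_chain_at) simp_all
  then have v: "((\<lambda>y. h (Complex x y)) has_vector_derivative (\<i> * h')) (at 0)" by (simp add: o_def)
  have re: "((\<lambda>y. Re (h (Complex x y))) has_real_derivative Re (\<i> * h')) (at 0)"
    using bounded_linear.has_vector_derivative[OF bounded_linear_Re v] by (simp add: has_real_derivative_iff_has_vector_derivative)
  have im: "((\<lambda>y. Im (h (Complex x y))) has_real_derivative Im (\<i> * h')) (at 0)"
    using bounded_linear.has_vector_derivative[OF bounded_linear_Im v] by (simp add: has_real_derivative_iff_has_vector_derivative)
  have "((\<lambda>y. (Re (h (Complex x y)))\<^sup>2 + (Im (h (Complex x y)))\<^sup>2) has_real_derivative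
      2 * Re (cnj (h (complex_of_real x)) * (\<i> * h'))) (at 0)"
    by (rule derivative_eq_intros re im refl)+ (simp add: C0)
  then show ?thesis by (simp add: cmod_power2)
qed

text \<open>On the real line \<open>sym\<close> and |\<Theta>| = 1 give \<Theta> - conj(\<omega>) G
  = \<Theta> conj(1 - \<omega> G), so the quotient of the two sides has modulus 1 there. Since r <
  1, its denominator is at least 1 - r in modulus, which bounds the quotient and admits the maximum
  principle.\<close>

lemma norm_diff_le_of_symmetric:
  fixes \<Theta> G :: "complex \<Rightarrow> complex"
  assumes S: "{z. Im z \<ge> 0} \<subseteq> S"
    and hol: "\<Theta> holomorphic_on S" "G holomorphic_on S"
    and \<Theta>_le: "\<And>z. Im z \<ge> 0 \<Longrightarrow> norm (\<Theta> z) \<le> 1"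
    and G_le: "\<And>z. Im z \<ge> 0 \<Longrightarrow> norm (G z) \<le> r" and r: "r < 1"
    and \<Theta>_real: "\<And>x. norm (\<Theta> (complex_of_real x)) = 1"
    and sym: "\<And>x. cnj (G (complex_of_real x)) = G (complex_of_real x) * cnj (\<Theta> (complex_of_real x))"
    and \<omega>: "norm \<omega> = 1" and z: "Im z \<ge> 0"
  shows "norm (\<Theta> z - cnj \<omega> * G z) \<le> norm (1 - \<omega> * G z)"
proof -
  have ge: "norm (1 - \<omega> * G w) \<ge> 1 - r" if "Im w \<ge> 0" for w
    using norm_triangle_ineq2[of 1 "\<omega> * G w"] G_le[OF that] \<omega> by (simp add: norm_mult)
  have ne: "1 - \<omega> * G w \<noteq> 0" if "Im w \<ge> 0" for w
    using ge[OF that] r by auto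
  have hol': "\<Theta> holomorphic_on {z. Im z > 0}" "G holomorphic_on {z. Im z > 0}"
    using hol S by (auto elim!: holomorphic_on_subset)
  have cont': "continuous_on {z. Im z \<ge> 0} \<Theta>" "continuous_on {z. Im z \<ge> 0} G"
    using hol S by (auto elim!: continuous_on_subset dest!: holomorphic_on_imp_continuous_on)
  have "norm ((\<Theta> z - cnj \<omega> * G z) / (1 - \<omega> * G z)) \<le> 1"
  proof (rule half_plane_maximum_principle[where h = "\<lambda>z. (\<Theta> z - cnj \<omega> * G z) / (1 - \<omega> * G z)"])
    show "(\<lambda>z. (\<Theta> z - cnj \<omega> * G z) / (1 - \<omega> * G z)) holomorphic_on {z. 0 < Im z}"
      using ne by (intro holomorphic_intros hol') auto
    show "continuous_on {z. 0 \<le> Im z} (\<lambda>z. (\<Theta> z - cnj \<omega> * G z) / (1 - \<omega> * G z))"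
      using ne by (intro continuous_intros cont') auto
    show "norm ((\<Theta> w - cnj \<omega> * G w) / (1 - \<omega> * G w)) \<le> 2 / (1 - r)" if "Im w \<ge> 0" for w
    proof -
      have "norm (\<Theta> w - cnj \<omega> * G w) \<le> 2"
        using norm_triangle_ineq4[of "\<Theta> w" "cnj \<omega> * G w"] \<Theta>_le[OF that] G_le[OF that] r \<omega>
        by (simp add: norm_mult)
      then show ?thesis unfolding norm_divide using ge[OF that] r by (intro frac_le) auto
    qed
    show "norm ((\<Theta> (of_real x) - cnj \<omega> * G (of_real x)) / (1 - \<omega> * G (of_real x))) \<le> 1" for x
    proof -
      have "\<Theta> (of_real x) * cnj (1 - \<omega> * G (of_real x)) = \<Theta> (of_real x) - cnj \<omega> * G (of_real x) * (\<Theta> (of_real x) * cnj (\<Theta> (of_real x)))"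
        by (simp add: sym algebra_simps)
      also have "\<Theta> (of_real x) * cnj (\<Theta> (of_real x)) = 1"
        using \<Theta>_real[of x] by (simp add: complex_norm_square[symmetric])
      finally have "norm (\<Theta> (of_real x) - cnj \<omega> * G (of_real x)) = norm (\<Theta> (of_real x) * cnj (1 - \<omega> * G (of_real x)))"
        by simp
      also have "\<dots> = norm (1 - \<omega> * G (of_real x))" by (simp only: norm_mult \<Theta>_real complex_mod_cnj mult_1)
      finally show ?thesis by (simp add: norm_divide)
    qed
  qed (rule z)
  then show ?thesis using ne[OF z] by (simp add: norm_divide)
qed

lemma deriv_nonneg_of_nonneg_right:
  fixes f :: "real \<Rightarrow> real"
  assumes "(f has_real_derivative D) (at 0)" "f 0 = 0" "\<And>y. y \<ge> 0 \<Longrightarrow> f y \<ge> 0"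
  shows "D \<ge> 0"
proof (rule ccontr)
  assume "\<not> D \<ge> 0"
  then obtain d where d: "d > 0" "\<And>h. 0 < h \<Longrightarrow> h < d \<Longrightarrow> f (0 + h) < f 0"
    using DERIV_neg_dec_right[OF assms(1)] by auto
  from d(2)[of "d/2"] d(1) assms(2) assms(3)[of "d/2"] show False by simp
qed

text \<open>For \<Theta>(z) = exp(2 i a z) with a > 0 this is the classical Duffin-Schaeffer
  inequality (\<gamma>')^2 + a^2 \<gamma>^2 \<le> a^2 for real functions of exponential type a, a
  sharpening of Bernstein's inequality. Differentiability of \<gamma> is part of the conclusion,
  since \<gamma> enters only through \<open>G\<close>.\<close>

lemma duffin_schaeffer:
  fixes \<Theta> G :: "complex \<Rightarrow> complex" and \<phi> \<gamma> :: "real \<Rightarrow> real"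
  assumes S: "open S" "{z. Im z \<ge> 0} \<subseteq> S"
    and hol: "\<Theta> holomorphic_on S" "G holomorphic_on S"
    and \<Theta>_le: "\<And>z. Im z \<ge> 0 \<Longrightarrow> norm (\<Theta> z) \<le> 1"
    and G_le: "\<And>z. Im z \<ge> 0 \<Longrightarrow> norm (G z) \<le> r" and r: "r < 1"
    and phase: "\<And>x. \<Theta> (complex_of_real x) = exp (\<i> * complex_of_real (\<phi> x))"
    and diff: "(\<phi> has_real_derivative k) (at x)"
    and G_real: "\<And>x. G (complex_of_real x) = complex_of_real (\<gamma> x) * exp (\<i> * complex_of_real (\<phi> x / 2))"
  shows "\<exists>d. (\<gamma> has_real_derivative d) (at x) \<and> \<bar>d\<bar> \<le> k / 2 * sqrt (1 - (\<gamma> x)\<^sup>2)"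
proof -
  \<comment> \<open>A unimodular square root of \<Theta> at \<open>x\<close>; factoring it out of
    \<open>G\<close>, \<Theta> and their derivatives leaves expressions in \<gamma>,
    \<open>d\<close> and \<open>k\<close> only.\<close>
  define e where "e = exp (\<i> * complex_of_real (\<phi> x / 2))"
  have e: "norm e = 1" "e * cnj e = 1" "cnj e * e = 1"
    by (simp_all add: e_def complex_norm_square[symmetric] mult.commute)
  have \<Theta>x: "\<Theta> (of_real x) = e * e"
    by (simp add: phase e_def exp_add[symmetric])
  have Gx: "G (of_real x) = of_real (\<gamma> x) * e" by (simp add: G_real e_def)
  define \<Theta>' G' where "\<Theta>' = deriv \<Theta> (of_real x)" and "G' = deriv G (of_real x)"
  have D\<Theta>: "(\<Theta> has_field_derivative \<Theta>') (at (of_real x))" and DG: "(G has_field_derivative G') (at (of_real x))"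
    unfolding \<Theta>'_def G'_def using S by (auto intro!: holomorphic_derivI hol)
  have vreal: "(complex_of_real has_vector_derivative 1) (at x)"
    using has_vector_derivative_of_real[OF DERIV_ident] by simp
  have v\<Theta>: "((\<lambda>t. \<Theta> (of_real t)) has_vector_derivative \<Theta>') (at x)"
    and vG: "((\<lambda>t. G (of_real t)) has_vector_derivative G') (at x)"
    using field_vector_diff_chain_at[OF vreal D\<Theta>] field_vector_diff_chain_at[OF vreal DG] by (simp_all add: o_def)
  have vphi: "((\<lambda>t. complex_of_real (\<phi> t)) has_vector_derivative complex_of_real k) (at x)"
    by (rule has_vector_derivative_of_real[OF diff])
  have vexp: "((\<lambda>t. exp (c * complex_of_real (\<phi> t))) has_vector_derivative c * of_real k * exp (c * of_real (\<phi> x))) (at x)" for c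
  proof -
    have "((\<lambda>z. exp (c * z)) has_field_derivative c * exp (c * of_real (\<phi> x))) (at (of_real (\<phi> x)))"
      by (auto intro!: derivative_eq_intros)
    from field_vector_diff_chain_at[OF vphi this] show ?thesis by (simp add: o_def mult_ac)
  qed
  have \<Theta>': "\<Theta>' = \<i> * of_real k * (e * e)"
  proof (rule vector_derivative_unique_at[OF v\<Theta>])
    show "((\<lambda>t. \<Theta> (of_real t)) has_vector_derivative \<i> * of_real k * (e * e)) (at x)"
      using vexp[of \<i>] by (simp add: phase e_def exp_add[symmetric])
  qed
  have \<gamma>eq: "complex_of_real (\<gamma> t) = G (of_real t) * exp (- (\<i> / 2) * of_real (\<phi> t))" for t
    by (simp add: G_real exp_add[symmetric] mult.assoc)
  have v\<gamma>: "((\<lambda>t. complex_of_real (\<gamma> t)) has_vector_derivative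
      G (of_real x) * (- (\<i> / 2) * of_real k * exp (- (\<i> / 2) * of_real (\<phi> x))) + G' * exp (- (\<i> / 2) * of_real (\<phi> x))) (at x)"
    (is "(_ has_vector_derivative ?c) _")
    unfolding \<gamma>eq by (rule has_vector_derivative_mult[OF vG vexp])
  \<comment> \<open>The derivative \<open>?c\<close> of a real-valued function is itself real. This
    lets \<open>G'\<close> be solved for in terms of \<open>d\<close>, \<open>k\<close> and
    \<gamma>.\<close>
  define d where "d = Re ?c"
  have D\<gamma>: "(\<gamma> has_real_derivative d) (at x)"
    using bounded_linear.has_vector_derivative[OF bounded_linear_Re v\<gamma>]
    by (simp add: has_real_derivative_iff_has_vector_derivative d_def)
  have "?c = of_real d"
    by (rule vector_derivative_unique_at[OF v\<gamma> has_vector_derivative_of_real[OF D\<gamma>]])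
  moreover have "exp (- (\<i> / 2) * of_real (\<phi> x)) = cnj e"
    by (simp add: e_def exp_cnj)
  ultimately have "of_real d * e = (G (of_real x) * (- (\<i> / 2) * of_real k * cnj e) + G' * cnj e) * e" by simp
  also have "\<dots> = (- (\<i> / 2) * of_real k * G (of_real x) + G') * (cnj e * e)" by (simp add: algebra_simps)
  also have "\<dots> = - (\<i> / 2) * of_real k * (of_real (\<gamma> x) * e) + G'" by (simp only: e Gx mult_1_right)
  finally have G': "G' = (of_real d + \<i> / 2 * of_real k * of_real (\<gamma> x)) * e" by (simp add: algebra_simps)
  have sym: "cnj (G (of_real t)) = G (of_real t) * cnj (\<Theta> (of_real t))" for t
  proof -
    define b where "b = exp (\<i> * complex_of_real (\<phi> t / 2))"
    have "\<Theta> (of_real t) = b * b" by (simp add: phase b_def exp_add[symmetric])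
    moreover have "G (of_real t) = of_real (\<gamma> t) * b" by (simp add: G_real b_def)
    moreover have "b * cnj b = 1" by (simp add: b_def complex_norm_square[symmetric])
    ultimately show ?thesis by (simp add: mult.assoc)
  qed
  have \<Theta>1: "norm (\<Theta> (of_real t)) = 1" for t by (simp add: phase)

  \<comment> \<open>This compares the normal derivatives at \<open>x\<close> of the two sides of \<open>norm_diff_le_of_symmetric\<close>, which agree on the real line.
    The best choice will be \<open>a = \<gamma> \<plusminus> \<i> sqrt (1 - \<gamma>\<^sup>2)\<close>.\<close>
  have main: "0 \<le> k * (1 - \<gamma> x * Re a) + 2 * d * Im a" if a: "norm a = 1" for a
  proof -
    \<comment> \<open>The factor conj(e) absorbs the phase, so that \<omega> G = a \<gamma> at
      \<open>x\<close>.\<close>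
    define \<omega> where "\<omega> = a * cnj e"
    have \<omega>: "norm \<omega> = 1" using a e by (simp add: \<omega>_def norm_mult)
    define h1 h2 where "h1 = (\<lambda>z. 1 - \<omega> * G z)" and "h2 = (\<lambda>z. \<Theta> z - cnj \<omega> * G z)"
    have D1: "(h1 has_field_derivative - (\<omega> * G')) (at (of_real x))"
      unfolding h1_def by (rule derivative_eq_intros DG refl)+ simp
    have D2: "(h2 has_field_derivative \<Theta>' - cnj \<omega> * G') (at (of_real x))"
      unfolding h2_def by (rule derivative_eq_intros DG D\<Theta> refl)+ simp
    have "norm (h2 (Complex x y)) \<le> norm (h1 (Complex x y))" if "y \<ge> 0" for y
      unfolding h1_def h2_def using that S
      by (intro norm_diff_le_of_symmetric[OF S(2) hol \<Theta>_le G_le r \<Theta>1 sym \<omega>]) auto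
    then have nonneg: "0 \<le> (norm (h1 (Complex x y)))\<^sup>2 - (norm (h2 (Complex x y)))\<^sup>2" if "y \<ge> 0" for y
      using that by (simp add: power_mono)
    define c where "c = of_real d + \<i> / 2 * of_real k * of_real (\<gamma> x)"
    have h1x: "h1 (of_real x) = 1 - a * of_real (\<gamma> x)"
      unfolding h1_def \<omega>_def Gx using e by (simp add: mult_ac)
    have h2x: "h2 (of_real x) = (1 - cnj a * of_real (\<gamma> x)) * (e * e)"
      unfolding h2_def \<omega>_def Gx \<Theta>x by (simp add: algebra_simps)
    have d1: "\<omega> * G' = a * c" unfolding \<omega>_def G' c_def[symmetric] using e by (simp add: mult_ac)
    have d2: "\<Theta>' - cnj \<omega> * G' = (\<i> * of_real k - cnj a * c) * (e * e)"
      unfolding \<omega>_def G' c_def[symmetric] \<Theta>' by (simp add: algebra_simps)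
    have "norm (h1 (of_real x)) = norm (h2 (of_real x))"
    proof -
      have "norm (1 - cnj a * of_real (\<gamma> x)) = norm (cnj (1 - a * of_real (\<gamma> x)))" by simp
      then show ?thesis unfolding h1x h2x norm_mult e by (simp only: complex_mod_cnj mult_1_right)
    qed
    then have zero: "(norm (h1 (Complex x 0)))\<^sup>2 - (norm (h2 (Complex x 0)))\<^sup>2 = 0" by (simp add: complex_of_real_def)
    have "0 \<le> 2 * Re (cnj (h1 (of_real x)) * (\<i> * - (\<omega> * G'))) - 2 * Re (cnj (h2 (of_real x)) * (\<i> * (\<Theta>' - cnj \<omega> * G')))"
      by (rule deriv_nonneg_of_nonneg_right[OF DERIV_diff[OF has_real_derivative_norm_square_vertical[OF D1]
              has_real_derivative_norm_square_vertical[OF D2]] zero nonneg])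
    also have "cnj (h2 (of_real x)) * (\<i> * (\<Theta>' - cnj \<omega> * G')) = (1 - a * of_real (\<gamma> x)) * (\<i> * (\<i> * of_real k - cnj a * c)) * ((e * cnj e) * (e * cnj e))"
      unfolding h2x d2 by (simp add: algebra_simps)
    also have "\<dots> = (1 - a * of_real (\<gamma> x)) * (\<i> * (\<i> * of_real k - cnj a * c))" by (simp only: e mult_1_right)
    also have "cnj (h1 (of_real x)) * (\<i> * - (\<omega> * G')) = (1 - cnj a * of_real (\<gamma> x)) * (\<i> * - (a * c))"
      unfolding h1x d1 by simp
    also have "2 * Re ((1 - cnj a * of_real (\<gamma> x)) * (\<i> * - (a * c))) - 2 * Re ((1 - a * of_real (\<gamma> x)) * (\<i> * (\<i> * of_real k - cnj a * c)))
        = 2 * (k * (1 - \<gamma> x * Re a) + 2 * d * Im a)"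
      by (simp add: c_def algebra_simps)
    finally show ?thesis by simp
  qed
  have "\<bar>\<gamma> x\<bar> \<le> r" using G_le[of "of_real x"] e by (simp add: Gx norm_mult)
  then have "(\<gamma> x)\<^sup>2 < 1" using r by (simp add: abs_square_less_1)
  define q where "q = sqrt (1 - (\<gamma> x)\<^sup>2)"
  have q: "q > 0" "q\<^sup>2 = 1 - (\<gamma> x)\<^sup>2" using \<open>(\<gamma> x)\<^sup>2 < 1\<close> by (simp_all add: q_def)
  \<comment> \<open>For a = cos t + i sin t and its conjugate, \<open>main\<close> bounds |d| by
    (k/2)(1 - \<gamma> cos t)/|sin t|. The factor of k/2 is smallest at cos t = \<gamma>, where it
    equals \<open>q\<close>.\<close>
  have "norm (Complex (\<gamma> x) q) = 1" "norm (Complex (\<gamma> x) (- q)) = 1"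
    using q by (simp_all add: cmod_def)
  from this[THEN main] have "0 \<le> k * q\<^sup>2 + 2 * d * q" "0 \<le> k * q\<^sup>2 - 2 * d * q"
    unfolding q(2) by (simp_all add: power2_eq_square)
  then have "0 \<le> q * (k * q + 2 * d)" "0 \<le> q * (k * q - 2 * d)"
    by (simp_all add: power2_eq_square algebra_simps)
  then have "0 \<le> k * q + 2 * d" "0 \<le> k * q - 2 * d"
    using q by (simp_all add: zero_le_mult_iff)
  then have "\<bar>d\<bar> \<le> k / 2 * q" by (simp add: abs_le_iff)
  with D\<gamma> show ?thesis unfolding q_def by blast
qed

section \<open>Comparison with the cosine\<close>

text \<open>The hypothesis \<open>bound\<close> says exactly that the derivative of arccos g has
  modulus at most \<open>k\<close>.\<close>

lemma arccos_lipschitz_of_derivative_bound: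
  fixes g g' :: "real \<Rightarrow> real"
  assumes deriv: "\<And>x. (g has_real_derivative g' x) (at x)"
    and less1: "\<And>x. \<bar>g x\<bar> < 1"
    and bound: "\<And>x. \<bar>g' x\<bar> \<le> k * sqrt (1 - (g x)\<^sup>2)"
  shows "\<bar>arccos (g x) - arccos (g y)\<bar> \<le> k * \<bar>x - y\<bar>"
proof -
  have d: "((\<lambda>x. arccos (g x)) has_real_derivative inverse (- sqrt (1 - (g x)\<^sup>2)) * g' x) (at x)" for x
    using less1[of x] by (intro DERIV_chain2[OF DERIV_arccos deriv]) auto
  have "\<bar>inverse (- sqrt (1 - (g x)\<^sup>2)) * g' x\<bar> \<le> k" for x
  proof -
    have "(g x)\<^sup>2 < 1" using less1[of x] by (simp add: abs_square_less_1)
    then have "sqrt (1 - (g x)\<^sup>2) > 0" by simp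
    then show ?thesis using bound[of x] by (simp add: abs_mult field_simps)
  qed
  then show ?thesis
    using field_differentiable_bound[of UNIV "\<lambda>x. arccos (g x)" "\<lambda>x. inverse (- sqrt (1 - (g x)\<^sup>2)) * g' x" k x y] d
    by auto
qed

text \<open>Replacing g by -g if necessary makes g(y) nonnegative. The Lipschitz bound then limits
  how far arccos g can grow, and \<open>small\<close> keeps the angle in [0, pi], where cos
  decreases.\<close>

lemma abs_ge_cos_of_derivative_bound:
  fixes g g' :: "real \<Rightarrow> real"
  assumes deriv: "\<And>x. (g has_real_derivative g' x) (at x)"
    and less1: "\<And>x. \<bar>g x\<bar> < 1"
    and bound: "\<And>x. \<bar>g' x\<bar> \<le> k * sqrt (1 - (g x)\<^sup>2)"
    and small: "arccos \<bar>g y\<bar> + k * \<bar>x - y\<bar> \<le> pi"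
  shows "cos (arccos \<bar>g y\<bar> + k * \<bar>x - y\<bar>) \<le> \<bar>g x\<bar>"
proof -
  have pos: "cos (arccos \<bar>h y\<bar> + k * \<bar>x - y\<bar>) \<le> \<bar>h x\<bar>"
    if h: "\<And>x. (h has_real_derivative h' x) (at x)" "\<And>x. \<bar>h x\<bar> < 1"
      "\<And>x. \<bar>h' x\<bar> \<le> k * sqrt (1 - (h x)\<^sup>2)" "arccos \<bar>h y\<bar> + k * \<bar>x - y\<bar> \<le> pi" "h y \<ge> 0"
    for h h' :: "real \<Rightarrow> real"
  proof -
    have "arccos (h x) \<le> arccos \<bar>h y\<bar> + k * \<bar>x - y\<bar>"
      using arccos_lipschitz_of_derivative_bound[OF h(1-3), of x y] h(5) by simp
    moreover have "0 \<le> arccos (h x)" using h(2)[of x] by (intro arccos_lbound) auto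
    ultimately have "cos (arccos \<bar>h y\<bar> + k * \<bar>x - y\<bar>) \<le> cos (arccos (h x))"
      using h(4) by (intro cos_monotone_0_pi_le) auto
    also have "\<dots> = h x" using h(2)[of x] by (intro cos_arccos) auto
    finally show ?thesis by simp
  qed
  show ?thesis
  proof (cases "g y \<ge> 0")
    case True
    then show ?thesis using pos[OF deriv less1 bound small] by simp
  next
    case False
    have "((\<lambda>x. - g x) has_real_derivative - g' x) (at x)" for x
      by (intro DERIV_minus deriv)
    from pos[OF this] show ?thesis using less1 bound small False by simp
  qed
qed

text \<open>The substitution t = sin^2 x turns the Beta integral into twice the integral of cos^p
  over [0, pi/2], and cos is even.\<close>

lemma nn_integral_cos_powr:
  fixes p :: real
  assumes p: "p > 0"
  shows "(\<integral>\<^sup>+x. ennreal (cos x powr p) * indicator {-(pi/2)..pi/2} x \<partial>lborel) = ennreal (Beta (1/2) ((p + 1) / 2))"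
proof -
  define I where "I = (\<integral>\<^sup>+x. ennreal (cos x powr p * indicator {0..pi/2} x) \<partial>lborel)"
  have "((\<lambda>t. t powr (-1/2) * (1 - t) powr ((p - 1) / 2)) has_integral Beta (1/2) ((p + 1) / 2)) {0..1}"
    using has_integral_Beta_real[of "1/2" "(p + 1) / 2"] p by (simp add: field_simps)
  from nn_integral_has_integral_lebesgue[OF _ this] have
     "ennreal (Beta (1/2) ((p + 1) / 2)) =
        nn_integral lborel (\<lambda>t. ennreal (t powr (-1/2) * (1 - t) powr ((p - 1) / 2) * indicator {(sin 0)\<^sup>2..(sin (pi/2))\<^sup>2} t))"
    by (simp add: mult_ac ennreal_mult' ennreal_indicator)
  also have "\<dots> = (\<integral>\<^sup>+ x. ennreal (((sin x)\<^sup>2) powr (-1/2) * (1 - (sin x)\<^sup>2) powr ((p - 1) / 2) * (2 * sin x * cos x) *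
                          indicator {0..pi/2} x) \<partial>lborel)"
    by (subst nn_integral_substitution[where g = "\<lambda>x. (sin x)\<^sup>2" and g' = "\<lambda>x. 2 * sin x * cos x"])
       (auto intro!: derivative_eq_intros continuous_intros mult_nonneg_nonneg[OF cos_ge_zero sin_ge_zero] simp: set_borel_measurable_def)
  also have "\<dots> = (\<integral>\<^sup>+ x. 2 * ennreal (cos x powr p * indicator {0..pi/2} x) \<partial>lborel)"
  \<comment> \<open>The end points are excluded: at 0 the left integrand is 0, as
    \<open>0 powr a = 0\<close>, but the right one is 2.\<close>
  proof (intro nn_integral_cong_AE AE_I[of _ _ "{0, pi/2}"])
    have *: "((sin x)\<^sup>2) powr (-1/2) * (1 - (sin x)\<^sup>2) powr ((p - 1) / 2) * (2 * sin x * cos x) = 2 * cos x powr p"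
      if "x > 0" "x < pi/2" for x
    proof -
      have s: "sin x > 0" and c: "cos x > 0" using that by (auto intro: sin_gt_zero cos_gt_zero)
      have e1: "((sin x)\<^sup>2) powr (-1/2) = inverse (sin x)"
        using s by (simp add: powr_minus powr_half_sqrt)
      have e2: "(1 - (sin x)\<^sup>2) powr ((p - 1) / 2) = cos x powr (p - 1)"
      proof -
        have "1 - (sin x)\<^sup>2 = cos x powr 2" using c by (simp add: cos_squared_eq)
        moreover have "2 * ((p - 1) / 2) = p - 1" by simp
        ultimately show ?thesis by (simp only: powr_powr)
      qed
      have e3: "cos x powr (p - 1) * cos x = cos x powr p"
        using c by (simp add: powr_mult_base mult.commute[of _ "cos x"])
      have "((sin x)\<^sup>2) powr (-1/2) * (1 - (sin x)\<^sup>2) powr ((p - 1) / 2) * (2 * sin x * cos x)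
          = inverse (sin x) * cos x powr (p - 1) * (2 * sin x * cos x)"
        by (simp only: e1 e2)
      also have "\<dots> = 2 * (cos x powr (p - 1) * cos x)" using s by (simp add: field_simps)
      finally show ?thesis by (simp only: e3)
    qed
    have "ennreal (((sin x)\<^sup>2) powr (-1/2) * (1 - (sin x)\<^sup>2) powr ((p - 1) / 2) * (2 * sin x * cos x) *
        indicator {0..pi/2} x) = 2 * ennreal (cos x powr p * indicator {0..pi/2} x)" if "x \<notin> {0, pi/2}" for x
    proof (cases "x \<in> {0..pi/2}")
      case True
      then have i: "indicator {0..pi/2} x = (1::real)" by simp
      have "0 < x" "x < pi/2" using True that by auto
      note eq = *[OF this]
      show ?thesis unfolding i mult_1_right eq by (simp add: ennreal_mult')
    qed simp
    then show "{x \<in> space lborel. \<not> ennreal (((sin x)\<^sup>2) powr (-1/2) * (1 - (sin x)\<^sup>2) powr ((p - 1) / 2) * (2 * sin x * cos x) *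
                          indicator {0..pi/2} x) = 2 * ennreal (cos x powr p * indicator {0..pi/2} x)} \<subseteq> {0, pi/2}"
      by blast
  qed (auto simp: emeasure_lborel_countable)
  also have "\<dots> = I + I"
    unfolding I_def by (subst nn_integral_cmult) (auto simp: mult_2)
  also have "\<dots> = (\<integral>\<^sup>+x. ennreal (cos x powr p * indicator {-(pi/2)..0} x) \<partial>lborel) + I"
    unfolding I_def
    by (subst (1) nn_integral_real_affine[of _ "-1" 0])
       (auto simp: indicator_def intro!: nn_integral_cong)
  also have "\<dots> = (\<integral>\<^sup>+x. ennreal (cos x powr p) * indicator {-(pi/2)..pi/2} x \<partial>lborel)"
    unfolding I_def
  proof (subst nn_integral_add[symmetric])
    have "ennreal (cos x powr p * indicator {-(pi/2)..0} x) + ennreal (cos x powr p * indicator {0..pi/2} x)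
        = ennreal (cos x powr p) * indicator {-(pi/2)..pi/2} x" if "x \<noteq> 0" for x
    proof (cases "x > 0")
      case True
      then have "- (pi/2) \<le> x" using pi_gt_zero by linarith
      with True show ?thesis by (simp add: indicator_def)
    next
      case False
      then have "x \<le> pi/2" using pi_gt_zero by linarith
      with False that show ?thesis by (simp add: indicator_def)
    qed
    then show "(\<integral>\<^sup>+x. ennreal (cos x powr p * indicator {-(pi/2)..0} x) + ennreal (cos x powr p * indicator {0..pi/2} x) \<partial>lborel)
        = (\<integral>\<^sup>+x. ennreal (cos x powr p) * indicator {-(pi/2)..pi/2} x \<partial>lborel)"
      by (intro nn_integral_cong_AE AE_I[of _ _ "{0}"]) auto
  qed auto
  finally show ?thesis ..
qed

text \<open>Log-convexity at q + 1, the midpoint of q + 1/2 and q + 3/2, combined with the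
  functional equation of Gamma at q + 1/2.\<close>

lemma Gamma_ratio_le:
  fixes q :: real
  assumes q: "q > 0"
  shows "Gamma (q + 1) \<le> sqrt (q + 1/2) * Gamma (q + 1/2)"
proof -
  have pos: "Gamma (q + 1) > 0" "Gamma (q + 1/2) > 0" "Gamma (q + 3/2) > 0"
    using q by (auto intro!: Gamma_real_pos)
  have "(ln \<circ> Gamma) ((1 - 1/2) *\<^sub>R (q + 1/2) + (1/2) *\<^sub>R (q + 3/2))
      \<le> (1 - 1/2) * (ln \<circ> Gamma) (q + 1/2) + (1/2) * (ln \<circ> Gamma) (q + 3/2)"
    using q by (intro convex_onD[OF log_convex_Gamma_real]) auto
  moreover have "(1 - 1/2) *\<^sub>R (q + 1/2) + (1/2) *\<^sub>R (q + 3/2) = q + 1"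
    by (simp add: algebra_simps)
  ultimately have "2 * ln (Gamma (q + 1)) \<le> ln (Gamma (q + 1/2)) + ln (Gamma (q + 3/2))"
    by (simp only: o_def) simp
  then have "ln ((Gamma (q + 1))\<^sup>2) \<le> ln (Gamma (q + 1/2) * Gamma (q + 3/2))"
    using pos by (simp add: ln_mult ln_realpow)
  then have "(Gamma (q + 1))\<^sup>2 \<le> Gamma (q + 1/2) * Gamma (q + 3/2)"
    using pos by (simp add: ln_le_cancel_iff)
  also have "Gamma (q + 3/2) = (q + 1/2) * Gamma (q + 1/2)"
  proof -
    have "q + 1/2 \<notin> \<int>\<^sub>\<le>\<^sub>0" using q by (auto elim!: nonpos_Ints_cases')
    from Gamma_plus1[OF this] show ?thesis by (simp add: add.assoc)
  qed
  also have "Gamma (q + 1/2) * ((q + 1/2) * Gamma (q + 1/2)) = (sqrt (q + 1/2) * Gamma (q + 1/2))\<^sup>2"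
    using q by (simp add: power_mult_distrib) (simp add: power2_eq_square)
  finally show ?thesis by (rule power2_le_imp_le) (use pos q in simp)
qed

lemma Beta_half_ge:
  fixes p :: real
  assumes p: "p > 0"
  shows "sqrt (2 * pi) / sqrt (p + 1) \<le> Beta (1/2) ((p + 1) / 2)"
proof -
  have pos: "Gamma (p/2 + 1) > 0" "Gamma (p/2 + 1/2) > 0"
    using p by (auto intro!: Gamma_real_pos)
  have eq: "(p + 1) / 2 = p/2 + 1/2" by (simp add: field_simps)
  have "Beta (1/2) ((p + 1) / 2) = sqrt pi * Gamma (p/2 + 1/2) / Gamma (p/2 + 1)"
    unfolding Beta_def eq by (simp add: Gamma_one_half_real add.commute)
  moreover have "sqrt pi / sqrt (p/2 + 1/2) \<le> sqrt pi * Gamma (p/2 + 1/2) / Gamma (p/2 + 1)"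
    using Gamma_ratio_le[of "p/2"] pos p by (simp add: field_simps)
  moreover have "sqrt pi / sqrt (p/2 + 1/2) = sqrt (2 * pi) / sqrt (p + 1)"
    unfolding eq[symmetric] by (simp flip: real_sqrt_divide)
  ultimately show ?thesis by simp
qed

lemma sqrt_diff_bigo: "(\<lambda>p. sqrt (p + 1) - sqrt p) \<in> O[at_top](\<lambda>p. p powr (-1/2))"
proof (rule bigoI[where c = 1])
  show "\<forall>\<^sub>F p in at_top. norm (sqrt (p + 1) - sqrt p) \<le> 1 * norm (p powr (-1/2))"
    using eventually_gt_at_top[of "0::real"]
  proof eventually_elim
    case (elim p)
    have "(sqrt (p + 1) - sqrt p) * sqrt p \<le> (sqrt (p + 1) - sqrt p) * (sqrt (p + 1) + sqrt p)"
      using elim by (intro mult_left_mono) auto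
    also have "\<dots> = 1" using elim by (simp add: algebra_simps)
    finally have "sqrt (p + 1) - sqrt p \<le> 1 / sqrt p" using elim by (simp add: field_simps)
    also have "1 / sqrt p = p powr (-1/2)" using elim by (simp add: powr_minus powr_half_sqrt field_simps)
    finally show ?case by simp
  qed
qed

text \<open>The supremum S need not be attained. Points \<open>X n\<close> with F (X n) tending to S
  and levels \<open>B n\<close> decreasing to S make the initial angle \<alpha> tend to 0, so the
  cosine minorants recentred at \<open>X n\<close> converge to S cos s; Fatou's lemma passes to the
  limit.\<close>

lemma nn_integral_powr_ge_of_cos_bound:
  fixes F :: "real \<Rightarrow> real" and k p :: real
  assumes meas: "F \<in> borel_measurable borel"
    and nonneg: "\<And>x. F x \<ge> 0"
    and bdd: "bdd_above (range F)"
    and k: "k > 0" and p: "p > 0"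
    and cos_le: "\<And>B x y. (SUP x. F x) < B \<Longrightarrow> arccos (F y / B) + k * \<bar>x - y\<bar> \<le> pi
      \<Longrightarrow> B * cos (arccos (F y / B) + k * \<bar>x - y\<bar>) \<le> F x"
  shows "ennreal ((SUP x. F x) powr p * Beta (1/2) ((p + 1) / 2))
      \<le> ennreal k * (\<integral>\<^sup>+x. ennreal (F x powr p) \<partial>lborel)"
proof (cases "(SUP x. F x) > 0")
  case False
  moreover have "(SUP x. F x) \<ge> 0" using cSUP_upper[OF UNIV_I bdd, of 0] nonneg[of 0] by linarith
  ultimately have "(SUP x. F x) = 0" by linarith
  then show ?thesis by simp
next
  case True
  define S where "S = (SUP x. F x)"
  have S: "S > 0" using True by (simp add: S_def)
  have F_le: "F x \<le> S" for x unfolding S_def by (rule cSUP_upper[OF UNIV_I bdd])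
  note [measurable] = meas
  have "\<exists>x. S - 1 / real (Suc n) < F x" for n
  proof -
    have "S - 1 / real (Suc n) < (SUP x. F x)" by (simp add: S_def)
    then show ?thesis using less_cSUP_iff[OF _ bdd] by blast
  qed
  then obtain X where X: "\<And>n. S - 1 / real (Suc n) < F (X n)" by metis
  define B where "B n = S + 1 / real (Suc n)" for n
  have B: "S < B n" for n by (simp add: B_def)
  have BS: "B \<longlonglongrightarrow> S" unfolding B_def
    using tendsto_add[OF tendsto_const LIMSEQ_inverse_real_of_nat] by (simp add: inverse_eq_divide)
  have "(\<lambda>n. F (X n)) \<longlonglongrightarrow> S"
  proof (rule real_tendsto_sandwich)
    show "(\<lambda>n. S - 1 / real (Suc n)) \<longlonglongrightarrow> S"
      using tendsto_diff[OF tendsto_const LIMSEQ_inverse_real_of_nat] by (simp add: inverse_eq_divide)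
    show "\<forall>\<^sub>F n in sequentially. S - 1 / real (Suc n) \<le> F (X n)"
      using X by (auto intro!: always_eventually less_imp_le)
    show "\<forall>\<^sub>F n in sequentially. F (X n) \<le> S" using F_le by auto
  qed auto
  then have ratio: "(\<lambda>n. F (X n) / B n) \<longlonglongrightarrow> 1"
    using tendsto_divide[OF _ BS] S by fastforce
  define \<alpha> where "\<alpha> n = arccos (F (X n) / B n)" for n
  have range: "0 \<le> F (X n) / B n" "F (X n) / B n \<le> 1" for n
    using nonneg[of "X n"] F_le[of "X n"] B[of n] S by (auto simp: divide_le_eq_1)
  have "\<alpha> \<longlonglongrightarrow> arccos 1"
    unfolding \<alpha>_def
    by (rule continuous_on_tendsto_compose[OF continuous_on_arccos' ratio])
       (use range in \<open>auto intro!: always_eventually order_trans[OF _ range(1)]\<close>)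
  then have \<alpha>0: "\<alpha> \<longlonglongrightarrow> 0" by simp
  \<comment> \<open>With |s| \<le> pi/2 this keeps the angle \<alpha> + |s| at most pi, as
    \<open>cos_le\<close> demands.\<close>
  have \<alpha>_le: "\<alpha> n \<le> pi / 2" for n
    unfolding \<alpha>_def using range by (intro arccos_le_pi2) auto
  define I where "I = (\<integral>\<^sup>+x. ennreal (F x powr p) \<partial>lborel)"
  \<comment> \<open>For \<alpha> > 0 the cosine is negative near the ends of the interval, hence the
    truncation at 0 before taking powers.\<close>
  define v where "v n s = ennreal (max 0 (B n * cos (\<alpha> n + \<bar>s\<bar>)) powr p) * indicator {-(pi/2)..pi/2} s" for n s
  have I_eq: "(\<integral>\<^sup>+s. ennreal (F (x + (1/k) * s) powr p) \<partial>lborel) = ennreal k * I" for x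
  proof -
    have "I = ennreal (1/k) * (\<integral>\<^sup>+s. ennreal (F (x + (1/k) * s) powr p) \<partial>lborel)"
      unfolding I_def using k
      by (subst nn_integral_real_affine[of "\<lambda>x. ennreal (F x powr p)" "1/k" x]) auto
    then have "ennreal k * I = (ennreal k * ennreal (1/k)) * (\<integral>\<^sup>+s. ennreal (F (x + (1/k) * s) powr p) \<partial>lborel)"
      by (simp only: mult.assoc)
    also have "ennreal k * ennreal (1/k) = 1" using k by (simp flip: ennreal_mult)
    finally show ?thesis by simp
  qed
  have v_le: "(\<integral>\<^sup>+s. v n s \<partial>lborel) \<le> ennreal k * I" for n
  proof -
    have "(\<integral>\<^sup>+s. v n s \<partial>lborel) \<le> (\<integral>\<^sup>+s. ennreal (F (X n + (1/k) * s) powr p) \<partial>lborel)"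
    proof (intro nn_integral_mono)
      fix s
      show "v n s \<le> ennreal (F (X n + (1/k) * s) powr p)"
      proof (cases "s \<in> {-(pi/2)..pi/2}")
        case True
        have eq: "k * \<bar>X n + (1/k) * s - X n\<bar> = \<bar>s\<bar>" using k by (simp add: abs_mult)
        have "arccos (F (X n) / B n) + k * \<bar>X n + (1/k) * s - X n\<bar> \<le> pi"
          unfolding eq using \<alpha>_le[of n] True unfolding \<alpha>_def by auto
        from cos_le[OF B[of n, unfolded S_def] this]
        have "B n * cos (\<alpha> n + \<bar>s\<bar>) \<le> F (X n + (1/k) * s)"
          unfolding eq \<alpha>_def by simp
        then have "max 0 (B n * cos (\<alpha> n + \<bar>s\<bar>)) powr p \<le> F (X n + (1/k) * s) powr p"
          using nonneg p by (intro powr_mono2) auto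
        then show ?thesis using True by (simp add: v_def ennreal_leI)
      qed (simp add: v_def)
    qed
    then show ?thesis unfolding I_eq .
  qed
  have lim: "(\<lambda>n. v n s) \<longlonglongrightarrow> ennreal (S powr p) * (ennreal (cos s powr p) * indicator {-(pi/2)..pi/2} s)" for s
  proof (cases "s \<in> {-(pi/2)..pi/2}")
    case True
    then have "cos s \<ge> 0" by (intro cos_ge_zero) auto
    have "(\<lambda>n. max 0 (B n * cos (\<alpha> n + \<bar>s\<bar>)) powr p) \<longlonglongrightarrow> max 0 (S * cos (0 + \<bar>s\<bar>)) powr p"
      using p by (intro tendsto_powr' tendsto_max tendsto_intros BS \<alpha>0) auto
    also have "max 0 (S * cos (0 + \<bar>s\<bar>)) powr p = S powr p * cos s powr p"
      using S \<open>cos s \<ge> 0\<close> by (simp add: powr_mult max_def)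
    finally have "(\<lambda>n. ennreal (max 0 (B n * cos (\<alpha> n + \<bar>s\<bar>)) powr p)) \<longlonglongrightarrow> ennreal (S powr p * cos s powr p)"
      by (rule tendsto_ennrealI)
    then show ?thesis using True by (simp add: v_def ennreal_mult)
  qed (simp add: v_def)
  have "ennreal (S powr p * Beta (1/2) ((p + 1) / 2)) = ennreal (S powr p) * (\<integral>\<^sup>+x. ennreal (cos x powr p) * indicator {-(pi/2)..pi/2} x \<partial>lborel)"
    unfolding nn_integral_cos_powr[OF p] by (simp add: ennreal_mult')
  also have "\<dots> = (\<integral>\<^sup>+s. ennreal (S powr p) * (ennreal (cos s powr p) * indicator {-(pi/2)..pi/2} s) \<partial>lborel)"
    by (intro nn_integral_cmult[symmetric]) measurable
  also have "\<dots> = (\<integral>\<^sup>+s. liminf (\<lambda>n. v n s) \<partial>lborel)"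
    by (intro nn_integral_cong lim_imp_Liminf[symmetric] lim) simp
  also have "\<dots> \<le> liminf (\<lambda>n. \<integral>\<^sup>+s. v n s \<partial>lborel)"
    unfolding v_def by (intro nn_integral_liminf) measurable
  also have "\<dots> \<le> ennreal k * I"
    by (intro Liminf_le always_eventually allI v_le) simp
  finally show ?thesis unfolding S_def I_def .
qed

section \<open>Hermite--Biehler functions with bounded phase derivative\<close>

lemma holomorphic_on_sharp:
  assumes "f holomorphic_on UNIV"
  shows "sharp f holomorphic_on UNIV"
proof -
  have "cnj \<circ> f \<circ> cnj holomorphic_on UNIV"
    using assms by (intro holomorphic_on_compose_cnj_cnj) (auto intro: holomorphic_on_subset)
  then show ?thesis by (simp add: sharp_def[abs_def] o_def)
qed

lemma sharp_sharp [simp]: "sharp (sharp f) = f"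
  by (simp add: sharp_def fun_eq_iff)

lemma sharp_of_real: "sharp f (complex_of_real x) = cnj (f (complex_of_real x))"
  by (simp add: sharp_def)

lemma norm_exp_i_diff_le: "norm (exp (\<i> * complex_of_real a) - exp (\<i> * complex_of_real b)) \<le> \<bar>a - b\<bar>"
proof -
  have "exp (\<i> * complex_of_real a) - exp (\<i> * complex_of_real b)
      = exp (\<i> * complex_of_real b) * (exp (\<i> * complex_of_real (a - b)) - 1)"
    by (simp add: algebra_simps flip: exp_add)
  then have "norm (exp (\<i> * complex_of_real a) - exp (\<i> * complex_of_real b)) = 2 * \<bar>sin ((a - b) / 2)\<bar>"
    by (simp only: norm_mult dist_exp_i_1) simp
  also have "\<dots> \<le> 2 * \<bar>(a - b) / 2\<bar>" by (intro mult_left_mono abs_sin_x_le_abs_x) auto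
  finally show ?thesis by simp
qed

text \<open>Here \<tau> is any positive bound rather than the supremum, so that the strip height
  1/(2\<tau>) makes sense.\<close>

locale bounded_phase =
  fixes E :: "complex \<Rightarrow> complex" and phi :: "real \<Rightarrow> real" and \<tau> :: real
  assumes hermite_biehler: "hermite_biehler E"
    and E_of_real: "\<And>x. E (complex_of_real x) \<noteq> 0"
    and phase: "phase_function E phi"
    and \<tau>_pos: "\<tau> > 0"
    and deriv_phase_le: "\<And>x. \<bar>deriv phi x\<bar> \<le> \<tau>"
begin

section \<open>Zeros and size of E and \<Theta> near the real line\<close>

lemma holomorphic_E: "E holomorphic_on A"
  using hermite_biehler holomorphic_on_subset unfolding hermite_biehler_def by blast

lemma E_nonzero: "E z \<noteq> 0" if "Im z \<ge> 0"
proof (cases "Im z = 0")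
  case True
  then have "z = complex_of_real (Re z)" by (simp add: complex_eq_iff)
  with E_of_real show ?thesis by metis
next
  case False
  with that have "norm (E (cnj z)) < norm (E z)"
    using hermite_biehler by (simp add: hermite_biehler_def)
  then show ?thesis by auto
qed

lemma open_E_nonzero: "open {z. E z \<noteq> 0}"
  by (intro open_Collect_neq holomorphic_on_imp_continuous_on holomorphic_E continuous_on_const)

lemma half_plane_subset: "{z. Im z \<ge> 0} \<subseteq> {z. E z \<noteq> 0}"
  using E_nonzero by auto

lemma holomorphic_quotient:
  assumes "f holomorphic_on UNIV"
  shows "(\<lambda>z. f z / E z) holomorphic_on {z. E z \<noteq> 0}"
  by (intro holomorphic_intros holomorphic_E holomorphic_on_subset[OF assms]) auto

lemma holomorphic_Theta: "Theta E holomorphic_on {z. E z \<noteq> 0}"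
  unfolding Theta_def[abs_def] by (intro holomorphic_quotient holomorphic_on_sharp holomorphic_E)

lemma Theta_of_real: "Theta E (complex_of_real x) = exp (\<i> * complex_of_real (phi x))"
  using phase by (simp add: phase_function_def)

lemma norm_Theta_le: "norm (Theta E z) \<le> 1" if "Im z \<ge> 0"
proof (cases "Im z = 0")
  case True
  then have "z = complex_of_real (Re z)" by (simp add: complex_eq_iff)
  then have "norm (Theta E z) = 1" using Theta_of_real[of "Re z"] by simp
  then show ?thesis by simp
next
  case False
  with that have "norm (E (cnj z)) < norm (E z)"
    using hermite_biehler by (simp add: hermite_biehler_def)
  then show ?thesis by (simp add: Theta_def sharp_def norm_divide divide_le_eq_1)
qed

lemma phase_has_derivative: "(phi has_real_derivative deriv phi x) (at x)"
  using phase by (simp add: phase_function_def DERIV_deriv_iff_real_differentiable)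

lemma phase_lipschitz: "\<bar>phi x - phi y\<bar> \<le> \<tau> * \<bar>x - y\<bar>"
  using field_differentiable_bound[of UNIV phi "deriv phi" \<tau> x y] phase_has_derivative deriv_phase_le by simp

lemma Theta_vertical: "norm (Theta E (Complex x y) - Theta E (complex_of_real x)) \<le> \<tau> * y" if "y \<ge> 0"
proof (rule half_plane_lipschitz_vertical[where C = 1])
  show "Theta E holomorphic_on {z. 0 < Im z}"
    using E_nonzero by (intro holomorphic_on_subset[OF holomorphic_Theta]) auto
  show "continuous_on {z. 0 \<le> Im z} (Theta E)"
    by (intro continuous_on_subset[OF holomorphic_on_imp_continuous_on[OF holomorphic_Theta]] half_plane_subset)
  show "norm (Theta E (complex_of_real x) - Theta E (complex_of_real y)) \<le> \<tau> * \<bar>x - y\<bar>" for x y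
    unfolding Theta_of_real by (rule order_trans[OF norm_exp_i_diff_le phase_lipschitz])
qed (use that norm_Theta_le in auto)

text \<open>Up to height 1/(2\<tau>) the vertical estimate takes away at most half of the modulus 1
  on the real line.\<close>

lemma norm_Theta_ge_half: "norm (Theta E z) \<ge> 1 / 2" if "0 \<le> Im z" "Im z \<le> 1 / (2 * \<tau>)"
proof -
  have "norm (Theta E z - Theta E (complex_of_real (Re z))) \<le> \<tau> * Im z"
    using Theta_vertical[of "Im z" "Re z"] that by simp
  also have "\<dots> \<le> 1 / 2" using that \<tau>_pos by (simp add: field_simps)
  finally have "norm (Theta E z - Theta E (complex_of_real (Re z))) \<le> 1 / 2" .
  moreover have "norm (Theta E (complex_of_real (Re z))) = 1" by (simp add: Theta_of_real)
  ultimately show ?thesis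
    using norm_triangle_ineq2[of "Theta E (complex_of_real (Re z))" "Theta E z"]
    by (simp add: norm_minus_commute)
qed

text \<open>|\<Theta>(conj z)| = |E(z)|/|E(conj z)|, so the lower bound for \<Theta> above the axis
  becomes one for E below it.\<close>

lemma norm_E_below:
  assumes "-(1 / (2 * \<tau>)) < Im z" "Im z < 0"
  shows "norm (E (cnj z)) \<le> 2 * norm (E z)"
proof -
  have "1 / 2 \<le> norm (Theta E (cnj z))" using assms by (intro norm_Theta_ge_half) auto
  moreover have "E (cnj z) \<noteq> 0" using assms by (intro E_nonzero) auto
  ultimately show ?thesis by (simp add: Theta_def sharp_def norm_divide field_simps)
qed

lemma E_nonzero_strip: "E z \<noteq> 0" if "-(1 / (2 * \<tau>)) < Im z"
proof (cases "Im z \<ge> 0")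
  case False
  then have "norm (E (cnj z)) \<le> 2 * norm (E z)" "E (cnj z) \<noteq> 0"
    using that by (auto intro!: norm_E_below E_nonzero)
  then show ?thesis by auto
qed (rule E_nonzero)

lemma norm_quotient_below:
  assumes "-(1 / (2 * \<tau>)) < Im z" "Im z < 0"
  shows "norm (f z / E z) \<le> 2 * norm (sharp f (cnj z) / E (cnj z))"
proof -
  have "E (cnj z) \<noteq> 0" "E z \<noteq> 0" using assms by (auto intro!: E_nonzero E_nonzero_strip)
  then have "norm (f z) / norm (E z) \<le> norm (f z) * (2 / norm (E (cnj z)))"
    using mult_left_mono[OF norm_E_below[OF assms] norm_ge_zero[of "f z"]] by (simp add: field_simps)
  then show ?thesis by (simp add: sharp_def norm_divide mult.commute)
qed

section \<open>Boundedness of f/E on the closed half plane\<close>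

lemma HpE_sharp: "sharp f \<in> HpE p E" if "f \<in> HpE p E"
  using that by (simp add: HpE_def holomorphic_on_sharp)

text \<open>A line at height y < 0 is reflected to height -y, where the Hardy condition on
  \<open>sharp f\<close> applies at the cost of a factor 2^p.\<close>

lemma bounded_quotient:
  assumes f: "f \<in> HpE p E" and p: "p > 0"
  shows "\<exists>C. \<forall>z. Im z \<ge> 0 \<longrightarrow> norm (f z / E z) \<le> C"
proof -
  have hol: "f holomorphic_on UNIV" using f by (simp add: HpE_def)
  obtain M1 where M1: "\<And>y. y > 0 \<Longrightarrow> (\<integral>\<^sup>+x. ennreal (norm (f (Complex x y) / E (Complex x y)) powr p) \<partial>lborel) \<le> ennreal M1"
    using f by (auto simp: HpE_def hardy_def)
  obtain M2 where M2: "\<And>y. y > 0 \<Longrightarrow> (\<integral>\<^sup>+x. ennreal (norm (sharp f (Complex x y) / E (Complex x y)) powr p) \<partial>lborel) \<le> ennreal M2"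
    using f by (auto simp: HpE_def hardy_def)
  define M where "M = max 0 (max M1 (2 powr p * max 0 M2))"
  show ?thesis
  proof (rule bounded_if_horizontal_integrals_bounded)
    show "(\<lambda>z. f z / E z) holomorphic_on {z. Im z > -(1 / (2 * \<tau>))}"
      using E_nonzero_strip by (intro holomorphic_on_subset[OF holomorphic_quotient[OF hol]]) auto
    show "1 / (2 * \<tau>) > 0" using \<tau>_pos by simp
    show "(\<integral>\<^sup>+x. ennreal (norm (f (Complex x y) / E (Complex x y)) powr p) \<partial>lborel) \<le> ennreal M"
      if y: "- (1 / (2 * \<tau>)) < y" "y \<noteq> 0" for y
    proof (cases "y > 0")
      case True
      then show ?thesis by (rule order_trans[OF M1]) (auto intro!: ennreal_leI simp: M_def)
    next
      case False
      then have y': "- y > 0" using y by simp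
      have cont: "continuous_on UNIV (\<lambda>x. sharp f (Complex x (- y)) / E (Complex x (- y)))"
        by (rule continuous_on_compose2[OF holomorphic_on_imp_continuous_on[OF holomorphic_quotient[OF holomorphic_on_sharp[OF hol]]]])
           (use y' in \<open>auto intro!: continuous_intros E_nonzero\<close>)
      have [measurable]: "(\<lambda>x. norm (sharp f (Complex x (- y)) / E (Complex x (- y))) powr p) \<in> borel_measurable borel"
        using p by (intro borel_measurable_continuous_onI continuous_on_powr' continuous_on_norm cont continuous_on_const) auto
      have "(\<integral>\<^sup>+x. ennreal (norm (f (Complex x y) / E (Complex x y)) powr p) \<partial>lborel)
          \<le> (\<integral>\<^sup>+x. ennreal (2 powr p) * ennreal (norm (sharp f (Complex x (- y)) / E (Complex x (- y))) powr p) \<partial>lborel)"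
      proof (rule nn_integral_mono)
        fix x
        have "cnj (Complex x y) = Complex x (- y)" by (simp add: complex_eq_iff)
        then have "norm (f (Complex x y) / E (Complex x y)) \<le> 2 * norm (sharp f (Complex x (- y)) / E (Complex x (- y)))"
          using norm_quotient_below[of "Complex x y" f] y y' by simp
        then have "norm (f (Complex x y) / E (Complex x y)) powr p \<le> (2 * norm (sharp f (Complex x (- y)) / E (Complex x (- y)))) powr p"
          using p by (intro powr_mono2) auto
        also have "\<dots> = 2 powr p * norm (sharp f (Complex x (- y)) / E (Complex x (- y))) powr p"
          by (rule powr_mult)
        finally show "ennreal (norm (f (Complex x y) / E (Complex x y)) powr p)
            \<le> ennreal (2 powr p) * ennreal (norm (sharp f (Complex x (- y)) / E (Complex x (- y))) powr p)"
          by (simp add: ennreal_leI flip: ennreal_mult)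
      qed
      also have "\<dots> = ennreal (2 powr p) * (\<integral>\<^sup>+x. ennreal (norm (sharp f (Complex x (- y)) / E (Complex x (- y))) powr p) \<partial>lborel)"
        by (rule nn_integral_cmult) measurable
      also have "\<dots> \<le> ennreal (2 powr p) * ennreal (max 0 M2)"
        by (intro mult_left_mono order_trans[OF M2[OF y']] ennreal_leI) auto
      also have "\<dots> = ennreal (2 powr p * max 0 M2)" by (simp add: ennreal_mult)
      also have "\<dots> \<le> ennreal M" by (intro ennreal_leI) (simp add: M_def)
      finally show ?thesis .
    qed
  qed (rule p)
qed

lemma quotient_le_of_real_le:
  assumes f: "f \<in> HpE p E" and p: "p > 0"
    and S: "\<And>x. norm (f (complex_of_real x) / E (complex_of_real x)) \<le> S" and z: "Im z \<ge> 0"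
  shows "norm (f z / E z) \<le> S"
proof -
  have hol: "(\<lambda>z. f z / E z) holomorphic_on {z. E z \<noteq> 0}"
    using f by (intro holomorphic_quotient) (simp add: HpE_def)
  obtain C where C: "\<And>z. Im z \<ge> 0 \<Longrightarrow> norm (f z / E z) \<le> C"
    using bounded_quotient[OF f p] by blast
  show ?thesis
  proof (rule half_plane_maximum_principle[where h = "\<lambda>z. f z / E z", OF _ _ C S z])
    show "(\<lambda>z. f z / E z) holomorphic_on {z. 0 < Im z}"
      using E_nonzero by (intro holomorphic_on_subset[OF hol]) auto
    show "continuous_on {z. 0 \<le> Im z} (\<lambda>z. f z / E z)"
      by (intro continuous_on_subset[OF holomorphic_on_imp_continuous_on[OF hol]] half_plane_subset)
  qed
qed

text \<open>Rotating f by a unimodular \<open>l\<close> and averaging with the reflected function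
  replaces f on the real line by Re(l f). This preserves the modulus at \<open>y\<close> and does
  not increase it elsewhere, so a lower bound for \<gamma> at \<open>x\<close> is one for
  f/E.\<close>

lemma quotient_cos_bound:
  assumes f: "f \<in> HpE p E" and p: "p > 0"
    and S: "\<And>x. norm (f (complex_of_real x) / E (complex_of_real x)) \<le> S" and B: "S < B"
    and small: "arccos (norm (f (complex_of_real y) / E (complex_of_real y)) / B) + \<tau> / 2 * \<bar>x - y\<bar> \<le> pi"
  shows "B * cos (arccos (norm (f (complex_of_real y) / E (complex_of_real y)) / B) + \<tau> / 2 * \<bar>x - y\<bar>)
    \<le> norm (f (complex_of_real x) / E (complex_of_real x))"
proof -
  have hol: "f holomorphic_on UNIV" using f by (simp add: HpE_def)
  have S0: "S \<ge> 0" using order_trans[OF norm_ge_zero S[of 0]] .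
  then have B0: "B > 0" using B by simp
  have Ssharp: "norm (sharp f (complex_of_real x) / E (complex_of_real x)) \<le> S" for x
    using S[of x] by (simp add: sharp_of_real norm_divide)
  obtain l where l: "norm l = 1" "l * f (complex_of_real y) = complex_of_real (norm (f (complex_of_real y)))"
  proof (cases "f (complex_of_real y) = 0")
    case True
    then show ?thesis using that[of 1] by simp
  next
    case False
    then show ?thesis using that[of "cnj (f (complex_of_real y)) / complex_of_real (norm (f (complex_of_real y)))"]
      by (simp add: norm_divide complex_norm_square[symmetric] power2_eq_square mult.commute)
  qed
  define G where "G z = (l * (f z / E z) + cnj l * (sharp f z / E z)) / complex_of_real (2 * B)" for z
  define \<gamma> where "\<gamma> t = Re (G (complex_of_real t) * exp (- (\<i> * complex_of_real (phi t / 2))))" for t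
  have holG: "G holomorphic_on {z. E z \<noteq> 0}"
    unfolding G_def using B0
    by (intro holomorphic_intros holomorphic_E holomorphic_on_subset[OF hol] holomorphic_on_subset[OF holomorphic_on_sharp[OF hol]]) auto
  have G_le: "norm (G z) \<le> S / B" if "Im z \<ge> 0" for z
  proof -
    have "norm (l * (f z / E z) + cnj l * (sharp f z / E z)) \<le> norm (l * (f z / E z)) + norm (cnj l * (sharp f z / E z))"
      by (rule norm_triangle_ineq)
    also have "\<dots> = norm (f z / E z) + norm (sharp f z / E z)" using l(1) by (simp only: norm_mult complex_mod_cnj mult_1)
    also have "\<dots> \<le> S + S"
      by (intro add_mono quotient_le_of_real_le[OF f p S that] quotient_le_of_real_le[OF HpE_sharp[OF f] p Ssharp that])
    finally have "norm (l * (f z / E z) + cnj l * (sharp f z / E z)) / (2 * B) \<le> (S + S) / (2 * B)"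
      using B0 by (intro divide_right_mono) auto
    then show ?thesis using B0 by (simp add: G_def norm_divide)
  qed
  have G_of_real: "G (complex_of_real t) = complex_of_real (Re (l * f (complex_of_real t)) / B) / E (complex_of_real t)" for t
  proof -
    have "l * f (complex_of_real t) + cnj l * sharp f (complex_of_real t) = complex_of_real (2 * Re (l * f (complex_of_real t)))"
      unfolding sharp_of_real by (simp add: complex_eq_iff)
    moreover have "G (complex_of_real t) = (l * f (complex_of_real t) + cnj l * sharp f (complex_of_real t)) / E (complex_of_real t) / complex_of_real (2 * B)"
      unfolding G_def by (simp only: times_divide_eq_right add_divide_distrib[symmetric])
    moreover have "complex_of_real (2 * v) / e / complex_of_real (2 * B) = complex_of_real (v / B) / e" for v e
      by simp
    ultimately show ?thesis by (simp only:)
  qed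
  have G_real: "G (complex_of_real t) = complex_of_real (\<gamma> t) * exp (\<i> * complex_of_real (phi t / 2))" for t
  proof -
    \<comment> \<open>As b^2 = \<Theta>, the product E b is real on the real line; \<open>w\<close>
      is a real multiple of 1/(E b) and therefore real.\<close>
    define b where "b = exp (\<i> * complex_of_real (phi t / 2))"
    have bb: "cnj b * b = 1" "b * cnj b = 1" by (simp_all add: b_def complex_norm_square[symmetric] mult.commute)
    have "cnj (E (complex_of_real t)) / E (complex_of_real t) = b * b"
      using Theta_of_real[of t] by (simp add: Theta_def sharp_of_real b_def exp_add[symmetric])
    then have cE: "cnj (E (complex_of_real t)) = b * b * E (complex_of_real t)"
      using E_of_real[of t] by (simp add: field_simps)
    have eb: "exp (- (\<i> * complex_of_real (phi t / 2))) = cnj b" by (simp add: b_def exp_cnj)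
    define w where "w = G (complex_of_real t) * cnj b"
    have "cnj w = complex_of_real (Re (l * f (complex_of_real t)) / B) / cnj (E (complex_of_real t)) * b"
      by (simp add: w_def G_of_real)
    also have "\<dots> = complex_of_real (Re (l * f (complex_of_real t)) / B) / E (complex_of_real t) * ((cnj b * b) * b / (b * b))"
      unfolding cE bb(1) by simp
    also have "(cnj b * b) * b / (b * b) = cnj b"
    proof -
      have "b * b \<noteq> 0" using bb by auto
      then show ?thesis unfolding mult.assoc by (rule nonzero_mult_div_cancel_right)
    qed
    finally have "cnj w = w" by (simp add: w_def G_of_real)
    then have "w = complex_of_real (Re w)" by (simp add: complex_eq_iff)
    also have "Re w = \<gamma> t" unfolding \<gamma>_def eb w_def ..
    finally have "w * b = complex_of_real (\<gamma> t) * b" by simp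
    then show ?thesis using bb unfolding w_def b_def[symmetric] by (simp add: mult.assoc)
  qed
  have abs\<gamma>: "\<bar>\<gamma> t\<bar> = norm (G (complex_of_real t))" for t
    unfolding G_real by (simp add: norm_mult)
  have r: "S / B < 1" using B B0 by simp
  have "\<exists>d. (\<gamma> has_real_derivative d) (at t) \<and> \<bar>d\<bar> \<le> deriv phi t / 2 * sqrt (1 - (\<gamma> t)\<^sup>2)" for t
    by (rule duffin_schaeffer[OF open_E_nonzero half_plane_subset holomorphic_Theta holG norm_Theta_le G_le r
        Theta_of_real phase_has_derivative G_real])
  then obtain \<gamma>' where \<gamma>': "\<And>t. (\<gamma> has_real_derivative \<gamma>' t) (at t)"
      "\<And>t. \<bar>\<gamma>' t\<bar> \<le> deriv phi t / 2 * sqrt (1 - (\<gamma> t)\<^sup>2)"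
    by metis
  have less1: "\<bar>\<gamma> t\<bar> < 1" for t
    unfolding abs\<gamma> using G_le[of "complex_of_real t"] r by simp
  have bound: "\<bar>\<gamma>' t\<bar> \<le> \<tau> / 2 * sqrt (1 - (\<gamma> t)\<^sup>2)" for t
  proof -
    have "(\<gamma> t)\<^sup>2 < 1" using less1[of t] by (simp add: abs_square_less_1)
    then show ?thesis
      using deriv_phase_le[of t] by (intro order_trans[OF \<gamma>'(2)] mult_right_mono) auto
  qed
  have abs\<gamma>_eq: "\<bar>\<gamma> t\<bar> = \<bar>Re (l * f (complex_of_real t))\<bar> / B / norm (E (complex_of_real t))" for t
    unfolding abs\<gamma> G_of_real norm_divide norm_of_real abs_divide using B0 by simp
  have \<gamma>y: "\<bar>\<gamma> y\<bar> = norm (f (complex_of_real y) / E (complex_of_real y)) / B"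
    unfolding abs\<gamma>_eq l(2) by (simp add: norm_divide mult.commute)
  have "B * \<bar>\<gamma> x\<bar> \<le> norm (f (complex_of_real x) / E (complex_of_real x))"
  proof -
    have "\<bar>Re (l * f (complex_of_real x))\<bar> \<le> norm (f (complex_of_real x))"
      using abs_Re_le_cmod[of "l * f (complex_of_real x)"] l(1) by (simp add: norm_mult)
    moreover have "B * (v / B / e) = v / e" for v e using B0 by simp
    ultimately show ?thesis
      unfolding abs\<gamma>_eq norm_divide by (simp only: divide_right_mono norm_ge_zero)
  qed
  moreover have "cos (arccos \<bar>\<gamma> y\<bar> + \<tau> / 2 * \<bar>x - y\<bar>) \<le> \<bar>\<gamma> x\<bar>"
    using small by (intro abs_ge_cos_of_derivative_bound[OF \<gamma>'(1) less1 bound]) (simp add: \<gamma>y)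
  then have "B * cos (arccos \<bar>\<gamma> y\<bar> + \<tau> / 2 * \<bar>x - y\<bar>) \<le> B * \<bar>\<gamma> x\<bar>"
    using B0 by (intro mult_left_mono) auto
  ultimately show ?thesis unfolding \<gamma>y by simp
qed

section \<open>From the cosine bound to the norm inequality\<close>

lemma continuous_on_quotient:
  assumes "f \<in> HpE p E"
  shows "continuous_on {z. Im z \<ge> 0} (\<lambda>z. f z / E z)"
proof -
  have "f holomorphic_on UNIV" using assms by (simp add: HpE_def)
  from holomorphic_on_imp_continuous_on[OF holomorphic_quotient[OF this]] half_plane_subset
  show ?thesis by (rule continuous_on_subset)
qed

lemma continuous_on_quotient_horizontal:
  assumes "f \<in> HpE p E" "y \<ge> 0"
  shows "continuous_on UNIV (\<lambda>x. f (Complex x y) / E (Complex x y))"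
  by (rule continuous_on_compose2[OF continuous_on_quotient[OF assms(1)]])
     (use assms(2) in \<open>auto intro!: continuous_intros\<close>)

text \<open>The integral in \<open>normp_E\<close> would be 0 for a non-integrable function, so
  integrability on the real line has to be secured. It follows by Fatou's lemma from the Hardy
  bounds at heights tending to 0.\<close>

lemma integrable_quotient_powr:
  assumes f: "f \<in> HpE p E" and p: "p > 0"
  shows "integrable lborel (\<lambda>x. norm (f (complex_of_real x) / E (complex_of_real x)) powr p)"
proof -
  obtain M where M: "\<And>y. y > 0 \<Longrightarrow> (\<integral>\<^sup>+x. ennreal (norm (f (Complex x y) / E (Complex x y)) powr p) \<partial>lborel) \<le> ennreal M"
    using f by (auto simp: HpE_def hardy_def)
  define u where "u y x = norm (f (Complex x y) / E (Complex x y)) powr p" for x y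
  have meas: "u y \<in> borel_measurable borel" if "y \<ge> 0" for y
    unfolding u_def using p
    by (intro borel_measurable_continuous_onI continuous_on_powr' continuous_on_norm
        continuous_on_quotient_horizontal[OF f that] continuous_on_const) auto
  have lim: "(\<lambda>n. ennreal (u (1 / real (Suc n)) x)) \<longlonglongrightarrow> ennreal (u 0 x)" for x
  proof -
    have "continuous_on {0..} (\<lambda>y. f (Complex x y) / E (Complex x y))"
      by (rule continuous_on_compose2[OF continuous_on_quotient[OF f]]) (auto intro!: continuous_intros)
    then have "continuous_on {0..} (\<lambda>y. u y x)"
      unfolding u_def using p by (intro continuous_on_powr' continuous_on_norm continuous_on_const) auto
    then have "(\<lambda>n. u (1 / real (Suc n)) x) \<longlonglongrightarrow> u 0 x"
      by (rule continuous_on_tendsto_compose) (use LIMSEQ_inverse_real_of_nat in \<open>auto simp: inverse_eq_divide\<close>)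
    then show ?thesis by (rule tendsto_ennrealI)
  qed
  have "(\<integral>\<^sup>+x. ennreal (u 0 x) \<partial>lborel) = (\<integral>\<^sup>+x. liminf (\<lambda>n. ennreal (u (1 / real (Suc n)) x)) \<partial>lborel)"
    by (intro nn_integral_cong lim_imp_Liminf[symmetric] lim) simp
  also have "\<dots> \<le> liminf (\<lambda>n. \<integral>\<^sup>+x. ennreal (u (1 / real (Suc n)) x) \<partial>lborel)"
    using meas by (intro nn_integral_liminf) auto
  also have "\<dots> \<le> ennreal M"
    unfolding u_def by (intro Liminf_le always_eventually allI M) simp_all
  finally have "(\<integral>\<^sup>+x. ennreal (u 0 x) \<partial>lborel) < \<infinity>" by (simp add: le_less_trans)
  then have "integrable lborel (u 0)"
    using meas[of 0] by (intro integrableI_nonneg) (auto simp: u_def)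
  moreover have "u 0 = (\<lambda>x. norm (f (complex_of_real x) / E (complex_of_real x)) powr p)"
    by (simp add: fun_eq_iff u_def complex_of_real_def)
  ultimately show ?thesis by simp
qed

lemma quotient_powr_le:
  assumes f: "f \<in> HpE p E" and p: "p > 0"
  shows "norm (f (complex_of_real x) / E (complex_of_real x)) powr p
    \<le> \<tau> * (1 / (2 * sqrt (2 * pi))) * sqrt (p + 1) * normp_E p E f powr p"
proof -
  define F where "F x = norm (f (complex_of_real x) / E (complex_of_real x))" for x
  define N where "N = (\<integral>x. F x powr p \<partial>lborel)"
  define S where "S = (SUP x. F x)"
  obtain C where "\<forall>z. Im z \<ge> 0 \<longrightarrow> norm (f z / E z) \<le> C"
    using bounded_quotient[OF f p] by blast
  then have C: "F x \<le> C" for x by (simp add: F_def)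
  have bdd: "bdd_above (range F)" using C by (auto intro!: bdd_aboveI)
  have F_le: "F x \<le> S" for x unfolding S_def by (rule cSUP_upper[OF UNIV_I bdd])
  have cont: "continuous_on UNIV F"
    using continuous_on_quotient_horizontal[OF f, of 0] unfolding F_def
    by (intro continuous_on_norm) (simp add: complex_of_real_def)
  have int: "integrable lborel (\<lambda>x. F x powr p)"
    using integrable_quotient_powr[OF f p] by (simp add: F_def)
  have N0: "N \<ge> 0" unfolding N_def by (intro integral_nonneg_AE) auto
  have "ennreal (S powr p * Beta (1/2) ((p + 1) / 2)) \<le> ennreal (\<tau> / 2) * (\<integral>\<^sup>+x. ennreal (F x powr p) \<partial>lborel)"
    unfolding S_def
  proof (rule nn_integral_powr_ge_of_cos_bound[OF _ _ bdd _ p])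
    show "F \<in> borel_measurable borel" by (rule borel_measurable_continuous_onI[OF cont])
    show "B * cos (arccos (F y / B) + \<tau> / 2 * \<bar>x - y\<bar>) \<le> F x"
      if "(SUP x. F x) < B" "arccos (F y / B) + \<tau> / 2 * \<bar>x - y\<bar> \<le> pi" for B x y
      unfolding F_def
      by (rule quotient_cos_bound[OF f p, of S]) (use that F_le in \<open>simp_all add: F_def S_def\<close>)
  qed (use \<tau>_pos in \<open>simp_all add: F_def\<close>)
  also have "(\<integral>\<^sup>+x. ennreal (F x powr p) \<partial>lborel) = ennreal N"
    unfolding N_def by (intro nn_integral_eq_integral int) auto
  also have "ennreal (\<tau> / 2) * ennreal N = ennreal (\<tau> / 2 * N)"
    using \<tau>_pos N0 by (simp flip: ennreal_mult)
  finally have SN: "S powr p * Beta (1/2) ((p + 1) / 2) \<le> \<tau> / 2 * N"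
    using \<tau>_pos N0 by (simp add: ennreal_le_iff)
  have "F x powr p * (sqrt (2 * pi) / sqrt (p + 1)) \<le> S powr p * Beta (1/2) ((p + 1) / 2)"
    using F_le[of x] p by (intro mult_mono Beta_half_ge powr_mono2) (auto simp: F_def)
  also note SN
  finally have "F x powr p \<le> \<tau> / 2 * N * (sqrt (p + 1) / sqrt (2 * pi))"
    using p by (simp add: field_simps)
  moreover have "normp_E p E f powr p = N"
    using p N0 by (simp add: normp_E_def N_def F_def powr_powr)
  ultimately show ?thesis by (simp add: F_def field_simps)
qed

end

section \<open>The embedding constant\<close>

lemma abs_deriv_le_sup_norm:
  assumes "bounded (range g)"
  shows "\<bar>g x\<bar> \<le> sup_norm g"
proof -
  obtain a where "\<And>x. \<bar>g x\<bar> \<le> a" using assms by (auto simp: bounded_iff)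
  then show ?thesis
    unfolding sup_norm_def by (intro cSUP_upper bdd_aboveI2[where M = a]) auto
qed

text \<open>Finiteness is stated separately because \<open>enn2real\<close> sends \<open>top\<close>
  to 0, which would make the second bound trivial.\<close>

lemma C_embed_powr_le:
  assumes E: "hermite_biehler E" "\<And>x. E (complex_of_real x) \<noteq> 0" "phase_function E phi"
    and bounded: "bounded (range (deriv phi))" and p: "p > 0"
  shows "C_embed p E < top"
    and "enn2real (C_embed p E) powr p \<le> sup_norm (deriv phi) * (1 / (2 * sqrt (2 * pi))) * sqrt (p + 1)"
proof -
  define c where "c = 1 / (2 * sqrt (2 * pi)) * sqrt (p + 1)"
  define \<tau> where "\<tau> = sup_norm (deriv phi)"
  have c: "c \<ge> 0" using p by (simp add: c_def)
  have \<tau>: "\<bar>deriv phi x\<bar> \<le> \<tau>" for x unfolding \<tau>_def by (rule abs_deriv_le_sup_norm[OF bounded])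
  have \<tau>0: "\<tau> \<ge> 0" using order_trans[OF abs_ge_zero \<tau>[of 0]] .
  have le: "norm (f (complex_of_real x) / E (complex_of_real x)) powr p \<le> \<tau> * c * normp_E p E f powr p"
    if f: "f \<in> HpE p E" for f x
  proof -
    have "norm (f (complex_of_real x) / E (complex_of_real x)) powr p \<le> (\<tau> + e) * c * normp_E p E f powr p"
      if "e > 0" for e
    proof -
      \<comment> \<open>Only \<tau> \<ge> 0 is known, while the locale needs a positive bound;
        \<open>e\<close> tends to 0 afterwards.\<close>
      interpret bounded_phase E phi "\<tau> + e"
        by unfold_locales (use E \<tau> \<tau>0 that in \<open>auto intro: add_nonneg_pos order_trans[OF \<tau>]\<close>)
      show ?thesis using quotient_powr_le[OF f p, of x] by (simp add: c_def mult_ac)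
    qed
    moreover have "((\<lambda>e. (\<tau> + e) * c * normp_E p E f powr p) \<longlongrightarrow> (\<tau> + 0) * c * normp_E p E f powr p) (at_right 0)"
      by (intro tendsto_intros)
    ultimately show ?thesis
      using tendsto_lowerbound[of "\<lambda>e. (\<tau> + e) * c * normp_E p E f powr p" "(\<tau> + 0) * c * normp_E p E f powr p" "at_right 0"]
      by (auto intro: eventually_mono[OF eventually_at_right_less])
  qed
  define K where "K = (\<tau> * c) powr (1 / p)"
  have "C_embed p E \<le> ennreal K"
    unfolding C_embed_def
  proof (intro Inf_lower CollectI ballI)
    fix f assume f: "f \<in> HpE p E"
    have N: "normp_E p E f \<ge> 0" by (simp add: normp_E_def)
    have "norm (f (complex_of_real x) / E (complex_of_real x)) \<le> K * normp_E p E f" for x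
    proof -
      have "(norm (f (complex_of_real x) / E (complex_of_real x)) powr p) powr (1 / p) \<le> (\<tau> * c * normp_E p E f powr p) powr (1 / p)"
        using p by (intro powr_mono2 le[OF f]) auto
      also have "\<dots> = K * (normp_E p E f powr p) powr (1 / p)" by (simp only: powr_mult K_def)
      finally show ?thesis using p N by (simp add: powr_powr)
    qed
    then show "norminf_E E f \<le> ennreal K * ennreal (normp_E p E f)"
      unfolding norminf_E_def using N
      by (intro SUP_least) (simp add: ennreal_leI K_def flip: ennreal_mult)
  qed
  then show "C_embed p E < top" by (rule le_less_trans) simp
  from \<open>C_embed p E \<le> ennreal K\<close> have "enn2real (C_embed p E) \<le> K"
    by (intro enn2real_leI) (simp_all add: K_def)
  then have "enn2real (C_embed p E) powr p \<le> K powr p"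
    using p by (intro powr_mono2) auto
  also have "\<dots> = \<tau> * c" using p \<tau>0 c by (simp add: K_def powr_powr)
  finally show "enn2real (C_embed p E) powr p \<le> sup_norm (deriv phi) * (1 / (2 * sqrt (2 * pi))) * sqrt (p + 1)"
    by (simp add: \<tau>_def c_def mult.assoc)
qed

theorem theorem3:
  shows "\<exists>R :: real \<Rightarrow> real. R \<in> O[at_top](\<lambda>p. p powr (-1/2)) \<and>
    (\<forall>E phi. hermite_biehler E \<and> (\<forall>x::real. E (complex_of_real x) \<noteq> 0) \<and>
       phase_function E phi \<and> bounded (range (deriv phi)) \<longrightarrow>
       (\<forall>p::real. 0 < p \<longrightarrow>
          C_embed p E < top \<and>
          enn2real (C_embed p E) powr p
            \<le> sup_norm (deriv phi) * (1 / (2 * sqrt (2 * pi))) * (sqrt p + R p)))"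
proof (intro exI[where x = "\<lambda>p. sqrt (p + 1) - sqrt p"] conjI allI impI sqrt_diff_bigo; elim conjE)
  fix E phi and p :: real
  assume E: "hermite_biehler E" "\<forall>x::real. E (complex_of_real x) \<noteq> 0" "phase_function E phi"
    "bounded (range (deriv phi))" and p: "0 < p"
  note * = C_embed_powr_le[OF E(1) E(2)[rule_format] E(3,4) p]
  show "C_embed p E < top" by (rule *(1))
  show "enn2real (C_embed p E) powr p
      \<le> sup_norm (deriv phi) * (1 / (2 * sqrt (2 * pi))) * (sqrt p + (sqrt (p + 1) - sqrt p))"
    using *(2) by simp
qed

end
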